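(* Let $U:\Omega\to\mathbb{R}$ be a potential depending on a finite number of coordinates, and let $\alpha$ be a Borel probability measure on $\Omega$. Then $\alpha$ is the equilibrium probability for $U$ if and only if $\alpha$ is $C^*$-Gibbs for $U$ (with parameter $\beta=1$). In particular, since the equilibrium probability for $U$ is unique, the $C^*$-Gibbs probability for $U$ is unique.
   Context: Space: $d$ is a positive integer, $\Omega=\{1,\dots,d\}^{\mathbb{Z}\setminus\{0\}}$ with the product topology; points are written $x=(\dots,x_{-2},x_{-1}\,|\,x_1,x_2,\dots)$. The shift $\tau:\Omega\to\Omega$ is the homeomorphism $\tau(\dots,x_{-2},x_{-1}\,|\,x_1,x_2,\dots)=(\dots,x_{-2},x_{-1},x_1\,|\,x_2,\dots)$. Cylinders: $\overline{x_{-n}\dots x_{-1}\,|\,x_1\dots x_m}$ is the set of $z\in\Omega$ with $z_j=x_j$ for $-n\le j\le m$, $j\ne0$; $\overline{|\,y_1\dots y_s}$ is the set of $z$ with $z_j=y_j$ for $1\le j\le s$. Homoclinic relation: $x\sim y$ if $x_j\neq y_j$ for only finitely many $j$. A potential $U$ depends on a finite number of coordinates if there is a finite set $F\subset\mathbb{Z}\setminus\{0\}$ such that $U(x)$ is determined by $(x_j)_{j\in F}$. For such $U$ and $x\sim y$ put $V(x,y)=\sum_{n=-\infty}^{\infty}\big(U(\tau^n x)-U(\tau^n y)\big)$ (only finitely many nonzero terms). Symmetric conjugating homeomorphisms: for $n\ge1$ and two strings $x_{-n},\dots,x_{-1},x_1,\dots,x_n$ and $y_{-n},\dots,y_{-1},y_1,\dots,y_n$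 in $\{1,\dots,d\}$, the map $\varphi:\overline{x_{-n}\dots x_{-1}|x_1\dots x_n}\to\overline{y_{-n}\dots y_{-1}|y_1\dots y_n}$ replaces the coordinates $-n,\dots,-1,1,\dots,n$ of $z$ by $y_{-n},\dots,y_{-1},y_1,\dots,y_n$ and leaves all other coordinates unchanged. $\alpha$ is $C^*$-Gibbs for $U$ (with $\beta=1$) if for every such $\varphi$, with domain $\mathcal{O}$, and every continuous $f:\Omega\to\mathbb{C}$, $$\int_{\mathcal{O}}e^{-V(z,\varphi(z))}f(\varphi(z))\,d\alpha(z)=\int_{\varphi(\mathcal{O})}f(z)\,d\alpha(z).$$ Equilibrium probability for $U$: the unique $\tau$-invariant Borel probability measure $\rho$ on $\Omega$ for which there exist constants $C_1,C_2>0$ and $P\in\mathbb{R}$ such that for all $s\ge0$, all cylinders $\overline{|\,y_1\dots y_s}$ and all $x\in\overline{|\,y_1\dots y_s}$, $$C_1\le\frac{\rho(\overline{|\,y_1\dots y_s})}{\exp\left(-Ps+\sum_{k=0}^{s-1}U(\tau^kx)\right)}\le C_2$$ (existence and uniqueness of such $\rho$, for Hölder potentials, is a classical theorem of Bowen). *)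

theory Defs
  imports "HOL-Probability.Probability"
begin

text \<open>A point has no coordinate at 0: as extensional functions, all points take the value
  \<open>undefined\<close> there. Hence \<open>int \<Rightarrow> nat\<close> restricted to \<open>seq_space d\<close> is exactly
  the product over the nonzero integers.\<close>

definition seq_space :: "nat \<Rightarrow> (int \<Rightarrow> nat) set" where
  "seq_space d = (- {0}) \<rightarrow>\<^sub>E {1..d}"

definition seq_topology :: "nat \<Rightarrow> (int \<Rightarrow> nat) topology" where
  "seq_topology d = product_topology (\<lambda>_. discrete_topology {1..d}) (- {0})"

definition borel_probability :: "nat \<Rightarrow> (int \<Rightarrow> nat) measure \<Rightarrow> bool" where
  "borel_probability d \<alpha> \<longleftrightarrow> prob_space \<alpha> \<and>
     sets \<alpha> = sigma_sets (seq_space d) {A. openin (seq_topology d) A}"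

text \<open>The index following -1 is 1.\<close>

definition shift :: "(int \<Rightarrow> nat) \<Rightarrow> int \<Rightarrow> nat" where
  "shift x = (\<lambda>j\<in>- {0}. if j = -1 then x 1 else x (j + 1))"

definition shift_power :: "nat \<Rightarrow> int \<Rightarrow> (int \<Rightarrow> nat) \<Rightarrow> int \<Rightarrow> nat" where
  "shift_power d n =
     (if n \<ge> 0 then shift ^^ nat n else inv_into (seq_space d) shift ^^ nat (- n))"

definition cylinder :: "nat \<Rightarrow> int set \<Rightarrow> (int \<Rightarrow> nat) \<Rightarrow> (int \<Rightarrow> nat) set" where
  "cylinder d J a = {z \<in> seq_space d. \<forall>j\<in>J. z j = a j}"

definition finite_range_potential :: "nat \<Rightarrow> ((int \<Rightarrow> nat) \<Rightarrow> real) \<Rightarrow> bool" where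
  "finite_range_potential d U \<longleftrightarrow>
     (\<exists>F. finite F \<and> F \<subseteq> - {0} \<and>
        (\<forall>x\<in>seq_space d. \<forall>y\<in>seq_space d. (\<forall>j\<in>F. x j = y j) \<longrightarrow> U x = U y))"

text \<open>For a finite range potential and points that differ in finitely many coordinates, all but
  finitely many terms vanish.\<close>

definition cocycle ::
  "nat \<Rightarrow> ((int \<Rightarrow> nat) \<Rightarrow> real) \<Rightarrow> (int \<Rightarrow> nat) \<Rightarrow> (int \<Rightarrow> nat) \<Rightarrow> real" where
  "cocycle d U x y = (\<Sum>\<^sub>\<infinity>n\<in>UNIV. U (shift_power d n x) - U (shift_power d n y))"

definition window :: "nat \<Rightarrow> int set" where
  "window n = {- int n..int n} - {0}"

definition replace_window :: "nat \<Rightarrow> (int \<Rightarrow> nat) \<Rightarrow> (int \<Rightarrow> nat) \<Rightarrow> int \<Rightarrow> nat" where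
  "replace_window n b z = (\<lambda>j. if j \<in> window n then b j else z j)"

text \<open>The inverse temperature is 1. The map \<open>replace_window n b\<close> sends the cylinder of
  \<open>a\<close> onto that of \<open>b\<close>.\<close>

definition c_star_gibbs :: "nat \<Rightarrow> ((int \<Rightarrow> nat) \<Rightarrow> real) \<Rightarrow> (int \<Rightarrow> nat) measure \<Rightarrow> bool" where
  "c_star_gibbs d U \<alpha> \<longleftrightarrow>
     (\<forall>n\<ge>1. \<forall>a \<in> window n \<rightarrow>\<^sub>E {1..d}. \<forall>b \<in> window n \<rightarrow>\<^sub>E {1..d}.
        \<forall>f :: (int \<Rightarrow> nat) \<Rightarrow> complex. continuous_map (seq_topology d) euclidean f \<longrightarrow>
          (LINT z:cylinder d (window n) a|\<alpha>.
             of_real (exp (- cocycle d U z (replace_window n b z))) * f (replace_window n b z))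
          = (LINT z:cylinder d (window n) b|\<alpha>. f z))"

definition shift_invariant :: "(int \<Rightarrow> nat) measure \<Rightarrow> bool" where
  "shift_invariant \<rho> \<longleftrightarrow>
     (\<forall>A\<in>sets \<rho>. shift -` A \<inter> space \<rho> \<in> sets \<rho> \<and> emeasure \<rho> (shift -` A \<inter> space \<rho>) = emeasure \<rho> A)"

definition bowen_bounds :: "nat \<Rightarrow> ((int \<Rightarrow> nat) \<Rightarrow> real) \<Rightarrow> (int \<Rightarrow> nat) measure \<Rightarrow> bool" where
  "bowen_bounds d U \<rho> \<longleftrightarrow>
     (\<exists>C1>0. \<exists>C2>0. \<exists>P::real. \<forall>s::nat. \<forall>y \<in> {1..int s} \<rightarrow>\<^sub>E {1..d}. \<forall>x \<in> cylinder d {1..int s} y.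
        C1 \<le> measure \<rho> (cylinder d {1..int s} y) / exp (- P * real s + (\<Sum>k<s. U ((shift ^^ k) x))) \<and>
        measure \<rho> (cylinder d {1..int s} y) / exp (- P * real s + (\<Sum>k<s. U ((shift ^^ k) x))) \<le> C2)"

definition equilibrium_candidate ::
  "nat \<Rightarrow> ((int \<Rightarrow> nat) \<Rightarrow> real) \<Rightarrow> (int \<Rightarrow> nat) measure \<Rightarrow> bool" where
  "equilibrium_candidate d U \<rho> \<longleftrightarrow>
     borel_probability d \<rho> \<and> shift_invariant \<rho> \<and> bowen_bounds d U \<rho>"

text \<open>Uniqueness is part of the definition, so that this says ``\<open>\<rho>\<close> is the unique
  candidate'' without presupposing Bowen's theorem.\<close>

definition equilibrium_probability ::
  "nat \<Rightarrow> ((int \<Rightarrow> nat) \<Rightarrow> real) \<Rightarrow> (int \<Rightarrow> nat) measure \<Rightarrow> bool" where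
  "equilibrium_probability d U \<rho> \<longleftrightarrow>
     equilibrium_candidate d U \<rho> \<and> (\<forall>\<rho>'. equilibrium_candidate d U \<rho>' \<longrightarrow> \<rho>' = \<rho>)"

end

theory Submission imports Defs begin

text \<open>
  The Gibbs condition says that \<open>\<integral> E\<^sub>n g d\<alpha> = \<integral> g d\<alpha>\<close> for the conditional expectations
  \<open>E\<^sub>n\<close> on symmetric windows. Because the potential has finite range, changing the boundary condition
  changes the energy of a window by a bounded amount, so \<open>E\<^sub>n\<close> contracts oscillations by a factor
  independent of \<open>n\<close>. Hence \<open>E\<^sub>n g\<close> converges uniformly to a constant \<open>mean g\<close> for every \<open>g\<close> that
  depends on finitely many coordinates; this gives existence, uniqueness, shift invariance and mixing
  of the Gibbs probability, and the same bounded distortion gives Bowen's inequalities. Conversely,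
  two invariant probabilities with Bowen bounds are comparable on cylinders, so any candidate \<open>\<rho>\<close> is
  dominated by \<open>C\<close> times the Gibbs probability. By mixing, averages of \<open>g\<close> along sparse translates
  tend to \<open>mean g\<close> in the Gibbs \<open>L\<^sup>2\<close> norm, therefore also in that of \<open>\<rho>\<close>, whence
  \<open>\<integral> g d\<rho> = mean g\<close>.
\<close>

text \<open>The Gibbs condition does not mention the shift and uses symmetric windows, while Bowen's
  cylinders start at coordinate 1. Two devices bridge the gap. Conditional expectations are defined
  on arbitrary intervals \<open>seg p q\<close>; each interval lies in a large symmetric window, so
  by the tower property all of them preserve the same \<open>mean\<close>. And under an invariant
  probability a symmetric window may be translated until it is one-sided.

  The contraction is Doeblin's: changing the boundary condition changes the conditional probability
  of an event inside the window at most by the factor \<open>rate\<close>, because only a bounded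
  number of energy terms reach across the two ends of an interval, however long it is.

  In the comparison of candidates the unknown constant \<open>P\<close> of Bowen's inequality is the
  obstacle; the total mass 1 of the cylinders eliminates it. What remains is an inequality for
  integrals of nonnegative local functions, so it is applied to the square of a centered sum. No
  density and no ergodic theorem enters: every estimate before the passage to the limit is about
  finite sums.\<close>

section \<open>Shift, fibers and dependence on coordinates\<close>

text \<open>Relabels the coordinates \<open>\<dots>, -2, -1, 1, 2, \<dots>\<close> by the integers without a gap, with 1 at
  position 0, so that the shift becomes a translation.\<close>

definition ix :: "int \<Rightarrow> int" where
  "ix i = (if i \<ge> 0 then i + 1 else i)"

text \<open>Inverse of \<open>ix\<close> on the nonzero integers. The value at 0 is arbitrary and
  coincides with that at 1, which is why \<open>mem_seg\<close> has to exclude 0.\<close>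

definition pos :: "int \<Rightarrow> int" where
  "pos j = (if j > 0 then j - 1 else j)"

lemma pos_ix [simp]: "pos (ix i) = i"
  by (auto simp: pos_def ix_def)

lemma ix_pos: "j \<noteq> 0 \<Longrightarrow> ix (pos j) = j"
  by (auto simp: pos_def ix_def)

lemma ix_nonzero [simp]: "ix i \<noteq> 0"
  by (auto simp: ix_def)

text \<open>Half-open intervals of gap-free positions: adjacent blocks share an end point, and a
  translation adds the same number to both ends. Symmetric windows and the coordinates
  \<open>1..s\<close> are both of this form.\<close>

definition seg :: "int \<Rightarrow> int \<Rightarrow> int set" where
  "seg p q = ix ` {p..<q}"

lemma finite_seg [simp]: "finite (seg p q)"
  by (simp add: seg_def)

lemma mem_seg: "j \<in> seg p q \<longleftrightarrow> j \<noteq> 0 \<and> p \<le> pos j \<and> pos j < q"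
  by (auto simp: seg_def intro!: image_eqI[where x = "pos j"] dest: ix_pos)

lemma window_eq_seg: "window n = seg (- int n) (int n)"
  by (auto simp: mem_seg window_def pos_def split: if_splits)

lemma Icc_eq_seg: "{1..int s} = seg 0 (int s)"
  by (auto simp: mem_seg pos_def split: if_splits)

lemma seg_mono: "p' \<le> p \<Longrightarrow> q \<le> q' \<Longrightarrow> seg p q \<subseteq> seg p' q'"
  by (auto simp: mem_seg)

lemma window_mono: "m \<le> n \<Longrightarrow> window m \<subseteq> window n"
  by (auto simp: window_def)

text \<open>All integer powers of the shift in one formula, so that negative powers need no
  \<open>inv_into\<close>.\<close>

definition translate :: "int \<Rightarrow> (int \<Rightarrow> nat) \<Rightarrow> int \<Rightarrow> nat" where
  "translate k x = (\<lambda>j\<in>- {0}. x (ix (pos j + k)))"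

lemma translate_ix [simp]: "translate k x (ix i) = x (ix (i + k))"
  by (simp add: translate_def)

lemma seq_space_mem: "x \<in> seq_space d \<longleftrightarrow> (\<forall>i. x (ix i) \<in> {1..d}) \<and> x 0 = undefined"
proof -
  have "(\<forall>j. j \<noteq> 0 \<longrightarrow> x j \<in> {1..d}) \<longleftrightarrow> (\<forall>i. x (ix i) \<in> {1..d})"
    by (metis ix_nonzero ix_pos)
  then show ?thesis
    by (auto simp: seq_space_def PiE_iff extensional_def)
qed

lemma seq_space_eqI:
  assumes "x \<in> seq_space d" "y \<in> seq_space d" "\<And>i. x (ix i) = y (ix i)"
  shows "x = y"
proof
  fix j
  show "x j = y j"
  proof (cases "j = 0")
    case True
    with assms(1,2) show ?thesis by (simp add: seq_space_mem)
  next
    case False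
    with assms(3)[of "pos j"] show ?thesis by (simp add: ix_pos)
  qed
qed

lemma translate_in [simp]: "x \<in> seq_space d \<Longrightarrow> translate k x \<in> seq_space d"
  by (simp add: seq_space_mem) (simp add: translate_def)

lemma translate_translate: "translate a (translate b x) = translate (a + b) x"
  by (rule ext) (auto simp: translate_def algebra_simps)

lemma translate_0: "x \<in> seq_space d \<Longrightarrow> translate 0 x = x"
  by (rule seq_space_eqI[where d = d]) auto

lemma shift_eq_translate: "shift x = translate 1 x"
proof
  fix j :: int
  show "shift x j = translate 1 x j"
    by (cases "j = 0"; cases "j = -1") (auto simp: shift_def translate_def ix_def pos_def add.commute)
qed

lemma shift_funpow: "x \<in> seq_space d \<Longrightarrow> (shift ^^ k) x = translate (int k) x"
  by (induction k) (auto simp: translate_0 shift_eq_translate translate_translate)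

lemma inv_shift:
  assumes "y \<in> seq_space d"
  shows "inv_into (seq_space d) shift y = translate (- 1) y"
proof (rule inv_into_f_eq)
  show "inj_on shift (seq_space d)"
    by (rule inj_on_inverseI[where g = "translate (- 1)"])
      (simp add: shift_eq_translate translate_translate translate_0)
  show "shift (translate (- 1) y) = y"
    using assms by (simp add: shift_eq_translate translate_translate translate_0)
qed (use assms in auto)

lemma inv_shift_funpow:
  "x \<in> seq_space d \<Longrightarrow> (inv_into (seq_space d) shift ^^ k) x = translate (- int k) x"
  by (induction k) (auto simp: translate_0 inv_shift translate_translate)

lemma shift_power_eq: "x \<in> seq_space d \<Longrightarrow> shift_power d k x = translate k x"
  by (simp add: shift_power_def shift_funpow inv_shift_funpow)

definition depends_on :: "nat \<Rightarrow> int set \<Rightarrow> ((int \<Rightarrow> nat) \<Rightarrow> 'b) \<Rightarrow> bool" where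
  "depends_on d J g \<longleftrightarrow>
     (\<forall>x\<in>seq_space d. \<forall>y\<in>seq_space d. (\<forall>j\<in>J. x j = y j) \<longrightarrow> g x = g y)"

lemma depends_onD:
  assumes "depends_on d J g" "x \<in> seq_space d" "y \<in> seq_space d" "\<And>j. j \<in> J \<Longrightarrow> x j = y j"
  shows "g x = g y"
  using assms unfolding depends_on_def by blast

lemma depends_onI:
  assumes "\<And>x y. x \<in> seq_space d \<Longrightarrow> y \<in> seq_space d \<Longrightarrow> (\<And>j. j \<in> J \<Longrightarrow> x j = y j) \<Longrightarrow> g x = g y"
  shows "depends_on d J g"
  using assms unfolding depends_on_def by blast

lemma depends_on_mono:
  assumes "depends_on d J g" "J \<subseteq> J'"
  shows "depends_on d J' g"
proof (rule depends_onI)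
  fix x y assume "x \<in> seq_space d" "y \<in> seq_space d" "\<And>j. j \<in> J' \<Longrightarrow> x j = y j"
  with assms(2) show "g x = g y"
    by (intro depends_onD[OF assms(1)]) auto
qed

lemma depends_on_comp:
  assumes "depends_on d J g"
  shows "depends_on d J (\<lambda>x. f (g x))"
proof (rule depends_onI)
  fix x y assume "x \<in> seq_space d" "y \<in> seq_space d" "\<And>j. j \<in> J \<Longrightarrow> x j = y j"
  then have "g x = g y" by (rule depends_onD[OF assms])
  then show "f (g x) = f (g y)" by simp
qed

lemma depends_on_comp2:
  assumes "depends_on d J g" "depends_on d J h"
  shows "depends_on d J (\<lambda>x. f (g x) (h x))"
proof (rule depends_onI)
  fix x y assume *: "x \<in> seq_space d" "y \<in> seq_space d" "\<And>j. j \<in> J \<Longrightarrow> x j = y j"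
  have "g x = g y" by (rule depends_onD[OF assms(1) *])
  moreover have "h x = h y" by (rule depends_onD[OF assms(2) *])
  ultimately show "f (g x) (h x) = f (g y) (h y)" by simp
qed

lemma depends_on_const: "depends_on d J (\<lambda>_. c)"
  by (simp add: depends_on_def)

text \<open>Position \<open>i\<close> of \<open>translate k x\<close> reads position
  \<open>i + k\<close> of \<open>x\<close>, so the interval of dependence moves to the
  right.\<close>

lemma depends_on_translate:
  assumes "depends_on d (seg p q) g"
  shows "depends_on d (seg (p + k) (q + k)) (\<lambda>x. g (translate k x))"
proof (rule depends_onI)
  fix x y assume xy: "x \<in> seq_space d" "y \<in> seq_space d" "\<And>j. j \<in> seg (p + k) (q + k) \<Longrightarrow> x j = y j"
  have "translate k x j = translate k y j" if "j \<in> seg p q" for j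
    using that xy(3) by (auto simp: seg_def)
  then show "g (translate k x) = g (translate k y)"
    using xy(1,2) by (intro depends_onD[OF assms]) auto
qed

text \<open>The state space of the finite volume \<open>J\<close> with boundary condition
  \<open>x\<close>; its members are full points, so energies can be evaluated on them
  directly.\<close>

definition fiber :: "nat \<Rightarrow> int set \<Rightarrow> (int \<Rightarrow> nat) \<Rightarrow> (int \<Rightarrow> nat) set" where
  "fiber d J x = {y \<in> seq_space d. \<forall>j. j \<notin> J \<longrightarrow> y j = x j}"

lemma fiber_in_space: "y \<in> fiber d J x \<Longrightarrow> y \<in> seq_space d"
  by (simp add: fiber_def)

lemma fiber_self: "x \<in> seq_space d \<Longrightarrow> x \<in> fiber d J x"
  by (simp add: fiber_def)

lemma fiber_sym: "x \<in> seq_space d \<Longrightarrow> y \<in> fiber d J x \<Longrightarrow> x \<in> fiber d J y"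
  by (auto simp: fiber_def)

lemma fiber_eq: "y \<in> fiber d J x \<Longrightarrow> fiber d J y = fiber d J x"
  by (auto simp: fiber_def)

lemma fiber_mono: "J \<subseteq> J' \<Longrightarrow> fiber d J x \<subseteq> fiber d J' x"
  by (auto simp: fiber_def)

lemma seq_space_range: "x \<in> seq_space d \<Longrightarrow> j \<noteq> 0 \<Longrightarrow> x j \<in> {1..d}"
  by (auto simp: seq_space_def PiE_iff)

lemma seq_space_0: "x \<in> seq_space d \<Longrightarrow> x 0 = undefined"
  by (auto simp: seq_space_def PiE_iff extensional_def)

lemma override_on_in_space [simp]:
  assumes "x \<in> seq_space d" "y \<in> seq_space d"
  shows "override_on x y J \<in> seq_space d"
  using assms by (auto simp: seq_space_def PiE_iff extensional_def override_on_def)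

lemma finite_fiber [simp]:
  assumes "finite J"
  shows "finite (fiber d J x)"
proof (rule finite_subset)
  show "fiber d J x \<subseteq> (\<lambda>w. override_on x w J) ` (J \<rightarrow>\<^sub>E insert undefined {1..d})"
  proof
    fix y assume y: "y \<in> fiber d J x"
    have "y j \<in> insert undefined {1..d}" for j
      using fiber_in_space[OF y] seq_space_range[of y d j] seq_space_0[of y d] by (cases "j = 0") auto
    then have "restrict y J \<in> J \<rightarrow>\<^sub>E insert undefined {1..d}"
      by (rule restrict_PiE_iff[THEN iffD2, rule_format])
    moreover have "y = override_on x (restrict y J) J"
      using y by (auto simp: fiber_def override_on_def)
    ultimately show "y \<in> (\<lambda>w. override_on x w J) ` (J \<rightarrow>\<^sub>E insert undefined {1..d})"
      by blast
  qed
next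
  show "finite ((\<lambda>w. override_on x w J) ` (J \<rightarrow>\<^sub>E insert undefined {1..d}))"
    using assms by (intro finite_imageI finite_PiE) auto
qed

lemma override_on_in_fiber:
  assumes "y \<in> seq_space d" "u \<in> seq_space d"
  shows "override_on y u J \<in> fiber d J y"
  using assms override_on_in_space[of y d u J] by (simp add: fiber_def)

text \<open>Exchanges the boundary condition while keeping the content of \<open>J\<close>. Sums for
  two boundary conditions can thereby be compared term by term.\<close>

lemma bij_betw_fiber:
  assumes "x \<in> seq_space d" "y \<in> seq_space d"
  shows "bij_betw (\<lambda>u. override_on y u J) (fiber d J x) (fiber d J y)"
proof (rule bij_betw_byWitness[where f' = "\<lambda>u. override_on x u J"])
  show "\<forall>u\<in>fiber d J x. override_on x (override_on y u J) J = u"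
    "\<forall>u\<in>fiber d J y. override_on y (override_on x u J) J = u"
    by (auto simp: fiber_def override_on_def)
qed (use assms override_on_in_fiber fiber_in_space in blast)+

lemma bij_betw_fiber_translate:
  assumes "x \<in> seq_space d"
  shows "bij_betw (translate k) (fiber d (seg (p + k) (q + k)) x) (fiber d (seg p q) (translate k x))"
proof (rule bij_betw_byWitness[where f' = "translate (- k)"])
  show "translate k ` fiber d (seg (p + k) (q + k)) x \<subseteq> fiber d (seg p q) (translate k x)"
  proof safe
    fix y assume y: "y \<in> fiber d (seg (p + k) (q + k)) x"
    have "translate k y j = translate k x j" if "j \<notin> seg p q" for j
      using y that by (cases "j = 0") (auto simp: fiber_def translate_def mem_seg)
    then show "translate k y \<in> fiber d (seg p q) (translate k x)"
      using y by (auto simp: fiber_def)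
  qed
  show "translate (- k) ` fiber d (seg p q) (translate k x) \<subseteq> fiber d (seg (p + k) (q + k)) x"
  proof safe
    fix y assume y: "y \<in> fiber d (seg p q) (translate k x)"
    have "translate (- k) y j = x j" if "j \<notin> seg (p + k) (q + k)" for j
    proof (cases "j = 0")
      case True
      with y assms show ?thesis by (auto simp: fiber_def seq_space_0 translate_def)
    next
      case False
      then have "translate (- k) y j = y (ix (pos j - k))"
        by (simp add: translate_def)
      also have "\<dots> = translate k x (ix (pos j - k))"
        using y that False by (auto simp: fiber_def mem_seg)
      finally show ?thesis
        using False by (simp add: ix_pos)
    qed
    then show "translate (- k) y \<in> fiber d (seg (p + k) (q + k)) x"
      using y by (auto simp: fiber_def)
  qed
qed (auto simp: translate_translate translate_0 fiber_def)

section \<open>Energies and conditional expectations\<close>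

text \<open>Any window on which \<open>U\<close> depends and any bound of its absolute value may
  serve as \<open>r\<close> and \<open>B\<close>; a finite range potential has both, since it takes
  only finitely many values. Positivity of \<open>d\<close> makes the space nonempty.\<close>

locale finite_range_system =
  fixes d :: nat and U :: "(int \<Rightarrow> nat) \<Rightarrow> real" and r :: nat and B :: real
  assumes d_pos: "d \<ge> 1"
    and U_depends: "depends_on d (window r) U"
    and U_bound: "x \<in> seq_space d \<Longrightarrow> \<bar>U x\<bar> \<le> B"
begin

abbreviation points :: "(int \<Rightarrow> nat) set" where
  "points \<equiv> seq_space d"

text \<open>A reference point. It is also fixed by the shift, which is what the computation of the
  pressure relies on.\<close>

definition ones :: "int \<Rightarrow> nat" where
  "ones = (\<lambda>j\<in>- {0}. 1)"

lemma ones_in [simp]: "ones \<in> points"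
  using d_pos by (auto simp: ones_def seq_space_def)

lemma B_nonneg: "B \<ge> 0"
  using U_bound[OF ones_in] by linarith

lemma U_translate_eq:
  assumes "x \<in> points" "y \<in> points" "\<And>j. j \<in> seg (k - int r) (k + int r) \<Longrightarrow> x j = y j"
  shows "U (translate k x) = U (translate k y)"
proof (rule depends_onD[OF U_depends])
  fix j assume "j \<in> window r"
  then obtain i where "j = ix i" "- int r \<le> i" "i < int r"
    by (auto simp: window_eq_seg seg_def)
  then show "translate k x j = translate k y j"
    using assms(3)[of "ix (i + k)"] by (simp add: mem_seg)
qed (use assms in auto)

text \<open>All terms of the formal Hamiltonian that see a coordinate of \<open>seg p q\<close>.\<close>

definition energy :: "int \<Rightarrow> int \<Rightarrow> (int \<Rightarrow> nat) \<Rightarrow> real" where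
  "energy p q x = (\<Sum>k\<in>{p - int r..<q + int r}. U (translate k x))"

text \<open>The margin is \<open>2 * r\<close> because the summation index overshoots the interval
  by \<open>r\<close> and each term reads \<open>r\<close> further positions.\<close>

lemma energy_cong:
  assumes "x \<in> points" "y \<in> points"
    "\<And>j. j \<in> seg (p - 2 * int r) (q + 2 * int r) \<Longrightarrow> x j = y j"
  shows "energy p q x = energy p q y"
  unfolding energy_def
proof (rule sum.cong)
  fix k assume k: "k \<in> {p - int r..<q + int r}"
  show "U (translate k x) = U (translate k y)"
  proof (rule U_translate_eq)
    fix j assume "j \<in> seg (k - int r) (k + int r)"
    with k show "x j = y j"
      by (intro assms(3)) (auto simp: mem_seg)
  qed (use assms in auto)
qed simp

lemma energy_translate: "energy p q (translate k x) = energy (p + k) (q + k) x"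
  unfolding energy_def
  by (rule sum.reindex_bij_witness[where i = "\<lambda>l. l - k" and j = "\<lambda>l. l + k"])
    (auto simp: translate_translate)

text \<open>A term with \<open>k\<close> outside the summation range reads only positions off
  \<open>seg p q\<close>, where the points agree. So the infinite sum is a difference of finite
  energies, and the Gibbs condition becomes a statement about the weights
  \<open>exp (energy p q x)\<close>.\<close>

lemma cocycle_eq:
  assumes "x \<in> points" "y \<in> fiber d (seg p q) x"
  shows "cocycle d U x y = energy p q x - energy p q y"
proof -
  have y: "y \<in> points"
    using assms(2) by (rule fiber_in_space)
  have "cocycle d U x y = (\<Sum>\<^sub>\<infinity>k\<in>UNIV. U (translate k x) - U (translate k y))"
    unfolding cocycle_def using assms(1) y by (simp add: shift_power_eq)
  also have "\<dots> = (\<Sum>\<^sub>\<infinity>k\<in>{p - int r..<q + int r}. U (translate k x) - U (translate k y))"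
  proof (rule infsum_cong_neutral)
    fix k assume k: "k \<in> UNIV - {p - int r..<q + int r}"
    have "U (translate k x) = U (translate k y)"
    proof (rule U_translate_eq)
      fix j assume "j \<in> seg (k - int r) (k + int r)"
      with k have "j \<notin> seg p q"
        by (auto simp: mem_seg)
      with assms(2) show "x j = y j"
        by (simp add: fiber_def)
    qed (use assms y in auto)
    then show "U (translate k x) - U (translate k y) = 0" by simp
  qed auto
  also have "\<dots> = energy p q x - energy p q y"
    by (simp add: energy_def sum_subtractf)
  finally show ?thesis .
qed

text \<open>Both differences equal the cocycle, which knows nothing of the interval. This is the
  consistency that makes the conditional expectations a tower.\<close>

lemma energy_diff_mono:
  assumes "x \<in> points" "y \<in> fiber d (seg p q) x" "p' \<le> p" "q \<le> q'"
  shows "energy p' q' x - energy p' q' y = energy p q x - energy p q y"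
proof -
  have "y \<in> fiber d (seg p' q') x"
    using assms(2) fiber_mono[OF seg_mono[OF assms(3,4)]] by blast
  then show ?thesis
    using assms cocycle_eq by metis
qed

text \<open>At most \<open>4 * r\<close> terms see beyond the two ends of the interval, and each
  changes by at most \<open>2 * B\<close>.\<close>

definition distortion :: real where
  "distortion = 8 * real r * B"

lemma distortion_nonneg: "distortion \<ge> 0"
  using B_nonneg by (simp add: distortion_def)

lemma U_translate_diff:
  assumes "x \<in> points" "y \<in> points"
  shows "\<bar>U (translate k x) - U (translate k y)\<bar> \<le> 2 * B"
  using U_bound[of "translate k x"] U_bound[of "translate k y"] assms by simp

lemma energy_distortion:
  assumes "x \<in> points" "y \<in> points" "\<And>j. j \<in> seg p q \<Longrightarrow> x j = y j"
  shows "\<bar>energy p q x - energy p q y\<bar> \<le> distortion"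
proof -
  let ?u = "\<lambda>k. \<bar>U (translate k x) - U (translate k y)\<bar>"
  \<comment> \<open>The indices within distance \<open>r\<close> of an end; every other term reads
    only positions of \<open>seg p q\<close>. The two blocks may overlap, so their sizes are merely
    added.\<close>
  let ?E = "{p - int r..<p + int r} \<union> {q - int r..<q + int r}"
  have "\<bar>energy p q x - energy p q y\<bar> \<le> (\<Sum>k\<in>{p - int r..<q + int r}. ?u k)"
    unfolding energy_def sum_subtractf[symmetric] by (rule sum_abs)
  also have "\<dots> \<le> (\<Sum>k\<in>?E. ?u k)"
  proof -
    have "(\<Sum>k\<in>{p - int r..<q + int r}. ?u k) = (\<Sum>k\<in>{p - int r..<q + int r} \<inter> ?E. ?u k)"
    proof (rule sum.mono_neutral_right)
      show "\<forall>k\<in>{p - int r..<q + int r} - {p - int r..<q + int r} \<inter> ?E. ?u k = 0"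
      proof
        fix k assume k: "k \<in> {p - int r..<q + int r} - {p - int r..<q + int r} \<inter> ?E"
        have "U (translate k x) = U (translate k y)"
          by (rule U_translate_eq) (use assms k in \<open>auto simp: mem_seg\<close>)
        then show "?u k = 0" by simp
      qed
    qed auto
    also have "\<dots> \<le> (\<Sum>k\<in>?E. ?u k)"
      by (rule sum_mono2) auto
    finally show ?thesis .
  qed
  also have "\<dots> \<le> real (card ?E) * (2 * B)"
    using U_translate_diff[OF assms(1,2)] by (intro sum_bounded_above) auto
  also have "\<dots> \<le> (4 * real r) * (2 * B)"
  proof (rule mult_right_mono)
    have "card ?E \<le> card {p - int r..<p + int r} + card {q - int r..<q + int r}"
      by (rule card_Un_le)
    then show "real (card ?E) \<le> 4 * real r"
      by simp
  qed (use B_nonneg in auto)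
  finally show ?thesis
    by (simp add: distortion_def)
qed

text \<open>The partition function of the finite volume with boundary condition \<open>x\<close>;
  \<open>expec\<close> is the corresponding finite-volume Gibbs expectation.\<close>

definition weight :: "int \<Rightarrow> int \<Rightarrow> (int \<Rightarrow> nat) \<Rightarrow> real" where
  "weight p q x = (\<Sum>y\<in>fiber d (seg p q) x. exp (energy p q y))"

definition expec :: "int \<Rightarrow> int \<Rightarrow> ((int \<Rightarrow> nat) \<Rightarrow> real) \<Rightarrow> (int \<Rightarrow> nat) \<Rightarrow> real" where
  "expec p q g x = (\<Sum>y\<in>fiber d (seg p q) x. exp (energy p q y) * g y) / weight p q x"

lemma weight_pos: "x \<in> points \<Longrightarrow> weight p q x > 0"
  unfolding weight_def using fiber_self[of x d "seg p q"] by (intro sum_pos) auto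

lemma weight_fiber: "y \<in> fiber d (seg p q) x \<Longrightarrow> weight p q y = weight p q x"
  unfolding weight_def by (simp add: fiber_eq)

lemma expec_add: "expec p q (\<lambda>y. g y + h y) x = expec p q g x + expec p q h x"
  by (simp add: expec_def sum.distrib algebra_simps add_divide_distrib)

lemma expec_mult_left: "expec p q (\<lambda>y. c * g y) x = c * expec p q g x"
  by (simp add: expec_def sum_distrib_left mult.left_commute)

lemma expec_const: "x \<in> points \<Longrightarrow> expec p q (\<lambda>_. c) x = c"
  using weight_pos[of x p q] by (simp add: expec_def weight_def sum_distrib_right[symmetric])

lemma expec_diff: "expec p q (\<lambda>y. g y - h y) x = expec p q g x - expec p q h x"
  by (simp add: expec_def sum_subtractf algebra_simps diff_divide_distrib)

lemma expec_mono:
  assumes "x \<in> points" "\<And>y. y \<in> fiber d (seg p q) x \<Longrightarrow> g y \<le> h y"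
  shows "expec p q g x \<le> expec p q h x"
  unfolding expec_def using assms weight_pos[of x p q]
  by (intro divide_right_mono sum_mono mult_left_mono) auto

lemma expec_cong:
  assumes "\<And>y. y \<in> fiber d (seg p q) x \<Longrightarrow> g y = h y"
  shows "expec p q g x = expec p q h x"
  unfolding expec_def using assms by simp

lemma expec_bounds:
  assumes "x \<in> points" "\<And>y. y \<in> points \<Longrightarrow> a \<le> g y \<and> g y \<le> b"
  shows "a \<le> expec p q g x" "expec p q g x \<le> b"
proof -
  have "expec p q (\<lambda>_. a) x \<le> expec p q g x" "expec p q g x \<le> expec p q (\<lambda>_. b) x"
    by (rule expec_mono; use assms fiber_in_space in blast)+
  with assms(1) show "a \<le> expec p q g x" "expec p q g x \<le> b"
    by (simp_all add: expec_const)
qed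

lemma expec_translate:
  assumes "x \<in> points"
  shows "expec p q g (translate k x) = expec (p + k) (q + k) (\<lambda>y. g (translate k y)) x"
proof -
  note bij = bij_betw_fiber_translate[OF assms, of k p q]
  have w: "weight p q (translate k x) = weight (p + k) (q + k) x"
    unfolding weight_def sum.reindex_bij_betw[OF bij, symmetric] by (simp add: energy_translate)
  show "expec p q g (translate k x) = expec (p + k) (q + k) (\<lambda>y. g (translate k y)) x"
    unfolding expec_def w sum.reindex_bij_betw[OF bij, symmetric] by (simp add: energy_translate)
qed

text \<open>Here the finite range allows iteration: conditioning a local function gives a local
  function again, on a window enlarged by at most \<open>2 * r\<close> on each side. The bijection
  that exchanges boundary conditions leaves every summand unchanged.\<close>

lemma expec_depends:
  assumes "depends_on d J g" "seg (p - 2 * int r) (q + 2 * int r) \<subseteq> J"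
  shows "depends_on d J (expec p q g)"
proof (rule depends_onI)
  fix x y assume xy: "x \<in> points" "y \<in> points" and eq: "\<And>j. j \<in> J \<Longrightarrow> x j = y j"
  let ?f = "\<lambda>u. override_on y u (seg p q)"
  note bij = bij_betw_fiber[OF xy, of "seg p q"]
  have e: "energy p q (?f u) = energy p q u" if "u \<in> fiber d (seg p q) x" for u
  proof (rule energy_cong)
    show "u \<in> points" "?f u \<in> points"
      using that xy fiber_in_space by auto
    fix j assume "j \<in> seg (p - 2 * int r) (q + 2 * int r)"
    with assms(2) eq that show "?f u j = u j"
      by (auto simp: fiber_def override_on_def subset_eq)
  qed
  have g: "g (?f u) = g u" if "u \<in> fiber d (seg p q) x" for u
  proof (rule depends_onD[OF assms(1)])
    show "u \<in> points" "?f u \<in> points"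
      using that xy fiber_in_space by auto
    fix j assume "j \<in> J"
    with eq that show "?f u j = u j"
      by (auto simp: fiber_def override_on_def)
  qed
  show "expec p q g x = expec p q g y"
    unfolding expec_def weight_def sum.reindex_bij_betw[OF bij, symmetric] by (simp add: e g)
qed

text \<open>Lying in the same fiber is a symmetric relation, so the double sum may be read in either order.\<close>

lemma expec_tower:
  assumes x: "x \<in> points" and le: "p' \<le> p" "q \<le> q'"
  shows "expec p' q' (expec p q g) x = expec p' q' g x"
proof -
  let ?N = "fiber d (seg p' q') x" and ?n = "fiber d (seg p q)"
  have sub: "seg p q \<subseteq> seg p' q'"
    using le by (rule seg_mono)
  have pts: "y \<in> points" if "y \<in> ?N" for y
    using that by (rule fiber_in_space)
  have restr: "?n y = {v \<in> ?N. v \<in> ?n y}" if "y \<in> ?N" for y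
    using that sub by (auto simp: fiber_def)
  have "(\<Sum>y\<in>?N. exp (energy p' q' y) * expec p q g y)
      = (\<Sum>y\<in>?N. \<Sum>v | v \<in> ?N \<and> v \<in> ?n y. exp (energy p' q' v) * exp (energy p q y) * g v / weight p q v)"
  proof (rule sum.cong)
    fix y assume y: "y \<in> ?N"
    have "exp (energy p' q' y) * expec p q g y
        = (\<Sum>v\<in>?n y. exp (energy p' q' y) * exp (energy p q v) * g v / weight p q y)"
      by (simp add: expec_def sum_distrib_left sum_divide_distrib mult_ac)
    also have "\<dots> = (\<Sum>v\<in>?n y. exp (energy p' q' v) * exp (energy p q y) * g v / weight p q v)"
    proof (rule sum.cong)
      fix v assume v: "v \<in> ?n y"
      have "energy p' q' y + energy p q v = energy p' q' v + energy p q y"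
        using energy_diff_mono[OF pts[OF y] v le] by simp
      then have "exp (energy p' q' y) * exp (energy p q v) = exp (energy p' q' v) * exp (energy p q y)"
        by (simp flip: exp_add)
      then show "exp (energy p' q' y) * exp (energy p q v) * g v / weight p q y
          = exp (energy p' q' v) * exp (energy p q y) * g v / weight p q v"
        by (simp add: weight_fiber[OF v])
    qed simp
    finally show "exp (energy p' q' y) * expec p q g y
      = (\<Sum>v | v \<in> ?N \<and> v \<in> ?n y. exp (energy p' q' v) * exp (energy p q y) * g v / weight p q v)"
      using restr[OF y] by simp
  qed simp
  also have "\<dots> = (\<Sum>v\<in>?N. \<Sum>y | y \<in> ?N \<and> v \<in> ?n y. exp (energy p' q' v) * exp (energy p q y) * g v / weight p q v)"
    by (rule sum.swap_restrict) auto
  also have "\<dots> = (\<Sum>v\<in>?N. exp (energy p' q' v) * g v)"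
  proof (rule sum.cong)
    fix v assume v: "v \<in> ?N"
    have "{y \<in> ?N. v \<in> ?n y} = ?n v"
      using restr[OF v] pts v by (auto intro: fiber_sym)
    then have "(\<Sum>y | y \<in> ?N \<and> v \<in> ?n y. exp (energy p' q' v) * exp (energy p q y) * g v / weight p q v)
       = exp (energy p' q' v) * g v * (\<Sum>y\<in>?n v. exp (energy p q y)) / weight p q v"
      by (simp add: sum_distrib_left sum_divide_distrib mult_ac)
    also have "\<dots> = exp (energy p' q' v) * g v"
      using weight_pos[OF pts[OF v], of p q] by (simp add: weight_def)
    finally show "(\<Sum>y | y \<in> ?N \<and> v \<in> ?n y. exp (energy p' q' v) * exp (energy p q y) * g v / weight p q v)
      = exp (energy p' q' v) * g v" .
  qed simp
  finally show ?thesis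
    by (simp add: expec_def[of p' q'])
qed

section \<open>Comparison of boundary conditions and contraction of oscillations\<close>

lemma weight_compare:
  assumes "x \<in> points" "y \<in> points"
  shows "weight p q y \<le> exp distortion * weight p q x"
proof -
  let ?f = "\<lambda>u. override_on y u (seg p q)"
  have "weight p q y = (\<Sum>u\<in>fiber d (seg p q) x. exp (energy p q (?f u)))"
    unfolding weight_def
    by (rule sum.reindex_bij_betw[OF bij_betw_fiber[OF assms, of "seg p q"], symmetric])
  also have "\<dots> \<le> (\<Sum>u\<in>fiber d (seg p q) x. exp distortion * exp (energy p q u))"
  proof (rule sum_mono)
    fix u assume u: "u \<in> fiber d (seg p q) x"
    have "\<bar>energy p q (?f u) - energy p q u\<bar> \<le> distortion"
      using fiber_in_space[OF u] assms by (intro energy_distortion) auto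
    then show "exp (energy p q (?f u)) \<le> exp distortion * exp (energy p q u)"
      by (simp flip: exp_add)
  qed
  finally show ?thesis
    by (simp add: weight_def sum_distrib_left)
qed

text \<open>One factor \<open>exp (- distortion)\<close> is lost in the numerator of
  \<open>expec\<close> and one in its partition function.\<close>

definition rate :: real where
  "rate = exp (- 2 * distortion)"

lemma rate_pos: "rate > 0" and rate_le_1: "rate \<le> 1"
  using distortion_nonneg by (auto simp: rate_def)

text \<open>Doeblin's minorization, with a factor independent of the interval. Since
  \<open>h\<close> looks only inside, exchanging the boundary condition changes the exponential
  weights but not the values of \<open>h\<close>.\<close>

lemma expec_compare:
  assumes "x \<in> points" "y \<in> points" "depends_on d (seg p q) h" "\<And>u. u \<in> points \<Longrightarrow> h u \<ge> 0"
  shows "expec p q h y \<ge> rate * expec p q h x"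
proof -
  let ?f = "\<lambda>u. override_on y u (seg p q)"
  have "exp (- distortion) * (\<Sum>u\<in>fiber d (seg p q) x. exp (energy p q u) * h u)
      \<le> (\<Sum>u\<in>fiber d (seg p q) x. exp (energy p q (?f u)) * h (?f u))"
    unfolding sum_distrib_left
  proof (rule sum_mono)
    fix u assume u: "u \<in> fiber d (seg p q) x"
    have fu: "?f u \<in> points" "u \<in> points"
      using fiber_in_space[OF u] assms by auto
    have "\<bar>energy p q (?f u) - energy p q u\<bar> \<le> distortion"
      using fu by (intro energy_distortion) auto
    then have "exp (- distortion) * exp (energy p q u) \<le> exp (energy p q (?f u))"
      by (simp flip: exp_add)
    moreover have "h (?f u) = h u"
      by (rule depends_onD[OF assms(3) fu]) simp
    ultimately show "exp (- distortion) * (exp (energy p q u) * h u) \<le> exp (energy p q (?f u)) * h (?f u)"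
      using assms(4)[OF fu(2)] by (simp add: mult_right_mono flip: mult.assoc)
  qed
  also have "\<dots> = (\<Sum>u\<in>fiber d (seg p q) y. exp (energy p q u) * h u)"
    by (rule sum.reindex_bij_betw[OF bij_betw_fiber[OF assms(1,2), of "seg p q"]])
  finally have num: "exp (- distortion) * (\<Sum>u\<in>fiber d (seg p q) x. exp (energy p q u) * h u)
      \<le> (\<Sum>u\<in>fiber d (seg p q) y. exp (energy p q u) * h u)" .
  have nn: "0 \<le> (\<Sum>u\<in>fiber d (seg p q) y. exp (energy p q u) * h u)"
    using assms(4) fiber_in_space by (intro sum_nonneg mult_nonneg_nonneg) auto
  have "rate * expec p q h x = exp (- distortion) * (\<Sum>u\<in>fiber d (seg p q) x. exp (energy p q u) * h u)
      / (exp distortion * weight p q x)"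
    by (simp add: rate_def expec_def exp_minus field_simps flip: exp_add)
  also have "\<dots> \<le> (\<Sum>u\<in>fiber d (seg p q) y. exp (energy p q u) * h u) / (exp distortion * weight p q x)"
    using weight_pos[OF assms(1), of p q] by (intro divide_right_mono num) auto
  also have "\<dots> \<le> expec p q h y"
    unfolding expec_def using weight_compare[OF assms(1,2)] weight_pos[OF assms(2)] nn
    by (intro divide_left_mono mult_pos_pos weight_pos[OF assms(1)]) auto
  finally show ?thesis .
qed

text \<open>After subtraction of the infimum \<open>a\<close> the function is nonnegative and
  Doeblin's bound applies. Hence \<open>E x - E y\<close>, where \<open>E = expec p q h\<close>, is
  at most \<open>1 - rate\<close> times \<open>E x - a\<close>, and \<open>E x - a\<close> is at
  most \<open>\<delta>\<close>.\<close>

lemma expec_contraction: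
  assumes h: "depends_on d (seg p q) h"
    and osc: "\<And>x y. x \<in> points \<Longrightarrow> y \<in> points \<Longrightarrow> \<bar>h x - h y\<bar> \<le> \<delta>"
    and xy: "x \<in> points" "y \<in> points"
  shows "\<bar>expec p q h x - expec p q h y\<bar> \<le> (1 - rate) * \<delta>"
proof -
  define a where "a = Inf (h ` points)"
  have bdd: "bdd_below (h ` points)"
    using osc[OF ones_in] by (intro bdd_belowI[where m = "h ones - \<delta>"]) (force simp: abs_le_iff)
  have a: "a \<le> h u" if "u \<in> points" for u
    unfolding a_def using that bdd by (intro cInf_lower) auto
  have b: "h u \<le> a + \<delta>" if "u \<in> points" for u
  proof -
    have "h u - \<delta> \<le> a"
      unfolding a_def
    proof (rule cInf_greatest)
      fix t assume "t \<in> h ` points"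
      then show "h u - \<delta> \<le> t"
        using osc[OF that] by (force simp: abs_le_iff)
    qed (use ones_in in blast)
    then show ?thesis by simp
  qed
  have one_sided: "expec p q h x - expec p q h y \<le> (1 - rate) * \<delta>"
    if "x \<in> points" "y \<in> points" for x y
  proof -
    have "rate * expec p q (\<lambda>u. h u - a) x \<le> expec p q (\<lambda>u. h u - a) y"
      using a that by (intro expec_compare depends_on_comp[OF h]) auto
    then have "rate * (expec p q h x - a) \<le> expec p q h y - a"
      using that by (simp add: expec_diff expec_const)
    moreover have "(1 - rate) * (expec p q h x - a) \<le> (1 - rate) * \<delta>"
      using expec_bounds(2)[OF that(1), of a h "a + \<delta>" p q] a b rate_le_1
      by (intro mult_left_mono) auto
    ultimately show ?thesis
      by (simp add: algebra_simps)
  qed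
  show ?thesis
    using one_sided[OF xy] one_sided[OF xy(2,1)] by (simp add: abs_le_iff)
qed

text \<open>One contraction per layer of thickness \<open>2 * r\<close>: the expectation over the
  inner window depends only on the next larger window, so it can play the role of \<open>h\<close>
  there, and the tower property merges the nested expectations.\<close>

lemma expec_osc_power:
  assumes g: "depends_on d (window m) g"
    and osc: "\<And>x y. x \<in> points \<Longrightarrow> y \<in> points \<Longrightarrow> \<bar>g x - g y\<bar> \<le> \<delta>"
    and xy: "x \<in> points" "y \<in> points" and n: "m + 2 * r * k \<le> n"
  shows "\<bar>expec (- int n) (int n) g x - expec (- int n) (int n) g y\<bar> \<le> (1 - rate) ^ k * \<delta>"
  using xy n
proof (induction k arbitrary: n x y)
  case 0
  from g have g': "depends_on d (seg (- int n) (int n)) g"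
    using 0 window_mono[of m n] by (auto simp flip: window_eq_seg intro: depends_on_mono)
  have "\<bar>expec (- int n) (int n) g x - expec (- int n) (int n) g y\<bar> \<le> (1 - rate) * \<delta>"
    by (rule expec_contraction[OF g' osc 0(1,2)])
  \<comment> \<open>The factor gained in the innermost window is given away, so that the exponent is
    exactly \<open>k\<close>.\<close>
  also have "\<dots> \<le> 1 * \<delta>"
    using rate_pos osc[OF ones_in ones_in] by (intro mult_right_mono) auto
  finally show ?case by simp
next
  case (Suc k)
  \<comment> \<open>The subtraction of naturals is exact, because \<open>2 * r * Suc k\<close> is at
    most \<open>n\<close>.\<close>
  define n' where "n' = n - 2 * r"
  have n': "m + 2 * r * k \<le> n'" "int n' = int n - 2 * int r" "m \<le> n" "n' \<le> n"
    using Suc.prems(3) by (auto simp: n'_def)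
  let ?h = "expec (- int n') (int n') g"
  have "depends_on d (seg (- int n) (int n)) ?h"
  proof (rule expec_depends)
    show "depends_on d (seg (- int n) (int n)) g"
      using depends_on_mono[OF g window_mono[OF n'(3)]] by (simp add: window_eq_seg)
  qed (simp add: n'(2))
  then have "\<bar>expec (- int n) (int n) ?h x - expec (- int n) (int n) ?h y\<bar> \<le> (1 - rate) * ((1 - rate) ^ k * \<delta>)"
    using Suc n'(1) by (intro expec_contraction) auto
  then show ?case
    using Suc.prems n'(4) by (simp add: expec_tower mult.assoc)
qed

end

section \<open>Local functions and the Borel sets\<close>

definition local_fun :: "nat \<Rightarrow> ((int \<Rightarrow> nat) \<Rightarrow> 'b) \<Rightarrow> bool" where
  "local_fun d g \<longleftrightarrow> (\<exists>m. depends_on d (window m) g)"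

text \<open>The algebra of finite unions of cylinders. Membership is treated as a local function
  with values in \<open>bool\<close>, so closure properties are instances of those of
  \<open>local_fun\<close>.\<close>

definition local_sets :: "nat \<Rightarrow> (int \<Rightarrow> nat) set set" where
  "local_sets d = {A. A \<subseteq> seq_space d \<and> local_fun d (\<lambda>x. x \<in> A)}"

lemma local_fun_comp: "local_fun d g \<Longrightarrow> local_fun d (\<lambda>x. f (g x))"
  unfolding local_fun_def by (blast intro: depends_on_comp)

lemma local_fun_common:
  assumes "local_fun d g" "local_fun d h"
  obtains m where "depends_on d (window m) g" "depends_on d (window m) h"
proof -
  from assms obtain m n where "depends_on d (window m) g" "depends_on d (window n) h"
    by (auto simp: local_fun_def)
  then show ?thesis
    using window_mono[of m "max m n"] window_mono[of n "max m n"] depends_on_mono that by (metis max.cobounded1 max.cobounded2)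
qed

lemma local_fun_comp2:
  assumes "local_fun d g" "local_fun d h"
  shows "local_fun d (\<lambda>x. f (g x) (h x))"
  using local_fun_common[OF assms] depends_on_comp2[of d _ g h f] unfolding local_fun_def by metis

lemma local_fun_cong:
  assumes "local_fun d g" "\<And>x. x \<in> seq_space d \<Longrightarrow> g x = h x"
  shows "local_fun d h"
  using assms unfolding local_fun_def depends_on_def by simp

lemma
  fixes g h :: "(int \<Rightarrow> nat) \<Rightarrow> real"
  assumes "local_fun d g" "local_fun d h"
  shows local_fun_diff: "local_fun d (\<lambda>x. g x - h x)"
    and local_fun_mult: "local_fun d (\<lambda>x. g x * h x)"
    and local_fun_divide: "local_fun d (\<lambda>x. g x / h x)"
  using assms by (rule local_fun_comp2)+

lemma local_fun_exp: "local_fun d g \<Longrightarrow> local_fun d (\<lambda>x. exp (g x :: real))"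
  by (rule local_fun_comp)

lemma local_fun_uminus: "local_fun d g \<Longrightarrow> local_fun d (\<lambda>x. - (g x :: real))"
  by (rule local_fun_comp)

lemma local_fun_const: "local_fun d (\<lambda>_. c)"
  by (auto simp: local_fun_def depends_on_const)

lemma seg_subset_window: "seg p q \<subseteq> window (nat (max \<bar>p\<bar> \<bar>q\<bar>))"
  by (auto simp: window_eq_seg mem_seg)

lemma depends_on_seg_local: "depends_on d (seg p q) g \<Longrightarrow> local_fun d g"
  unfolding local_fun_def using depends_on_mono seg_subset_window by blast

lemma local_fun_translate:
  assumes "local_fun d g"
  shows "local_fun d (\<lambda>x. g (translate k x))"
proof -
  from assms obtain m where "depends_on d (seg (- int m) (int m)) g"
    by (auto simp: local_fun_def window_eq_seg)
  then show ?thesis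
    by (intro depends_on_seg_local[OF depends_on_translate])
qed

lemma local_fun_sum:
  fixes g :: "'i \<Rightarrow> (int \<Rightarrow> nat) \<Rightarrow> 'b::comm_monoid_add"
  assumes "\<And>i. i \<in> I \<Longrightarrow> local_fun d (g i)"
  shows "local_fun d (\<lambda>x. \<Sum>i\<in>I. g i x)"
proof (cases "finite I")
  case True
  then show ?thesis
    using assms by (induction I) (auto simp: local_fun_const intro: local_fun_comp2)
qed (simp add: local_fun_const)

lemma cylinder_local:
  assumes "finite J" "0 \<notin> J"
  shows "cylinder d J a \<in> local_sets d"
proof -
  obtain m where "\<forall>j\<in>J. \<bar>j\<bar> \<le> int m"
  proof
    \<comment> \<open>The sum of the absolute values is a crude bound that also covers the empty
      set.\<close>
    show "\<forall>j\<in>J. \<bar>j\<bar> \<le> int (nat (\<Sum>j\<in>J. \<bar>j\<bar>))"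
      using assms(1) by (auto intro: member_le_sum simp: sum_nonneg)
  qed
  with assms(2) have "J \<subseteq> window m"
    by (force simp: window_def)
  moreover have "depends_on d J (\<lambda>x. x \<in> cylinder d J a)"
    by (rule depends_onI) (simp add: cylinder_def)
  ultimately show ?thesis
    by (auto simp: local_sets_def local_fun_def cylinder_def dest: depends_on_mono)
qed

text \<open>All values are already attained on one finite fiber: the content of the window is
  transplanted onto a fixed point.\<close>

lemma local_fun_finite_image:
  assumes "d \<ge> 1" "local_fun d g"
  shows "finite (g ` seq_space d)"
proof -
  from assms(2) obtain m where m: "depends_on d (window m) g"
    by (auto simp: local_fun_def)
  define e :: "int \<Rightarrow> nat" where "e = (\<lambda>j\<in>- {0}. 1)"
  have e: "e \<in> seq_space d"
    using assms(1) by (auto simp: e_def seq_space_def)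
  have "g ` seq_space d \<subseteq> g ` fiber d (window m) e"
  proof safe
    fix x assume x: "x \<in> seq_space d"
    have "g x = g (override_on e x (window m))"
      using x e by (intro depends_onD[OF m]) auto
    then show "g x \<in> g ` fiber d (window m) e"
      using override_on_in_fiber[OF e x] by blast
  qed
  then show ?thesis
    by (rule finite_subset) (simp add: window_eq_seg)
qed

lemma local_fun_bounded:
  fixes g :: "(int \<Rightarrow> nat) \<Rightarrow> 'b::real_normed_vector"
  assumes "d \<ge> 1" "local_fun d g"
  obtains b where "\<And>x. x \<in> seq_space d \<Longrightarrow> norm (g x) \<le> b"
proof -
  have "finite ((\<lambda>x. norm (g x)) ` seq_space d)"
    by (rule local_fun_finite_image[OF assms(1) local_fun_comp[OF assms(2)]])
  from bdd_above_finite[OF this] show ?thesis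
    using that by (auto simp: bdd_above_def)
qed

section \<open>Local sets, the product topology and the Borel sigma-algebra\<close>

lemma topspace_seq_topology: "topspace (seq_topology d) = seq_space d"
  by (simp add: seq_topology_def seq_space_def)

lemma compact_space_seq_topology: "compact_space (seq_topology d)"
  by (simp add: seq_topology_def compact_space_product_topology compact_space_discrete_topology)

lemma local_sets_openin:
  assumes "A \<in> local_sets d"
  shows "openin (seq_topology d) A"
proof -
  from assms obtain m where A: "A \<subseteq> seq_space d" and m: "depends_on d (window m) (\<lambda>x. x \<in> A)"
    by (auto simp: local_sets_def local_fun_def)
  show ?thesis
    unfolding seq_topology_def openin_product_topology_alt
  proof (intro ballI exI conjI)
    fix x assume x: "x \<in> A"
    then have xs: "x \<in> seq_space d" using A by auto
    let ?U = "\<lambda>i. if i \<in> window m then {x i} else {1..d}"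
    show "finite {i \<in> - {0}. ?U i \<noteq> topspace (discrete_topology {1..d})}"
      by (rule finite_subset[of _ "window m"]) (auto simp: window_eq_seg)
    show "x \<in> Pi\<^sub>E (- {0}) ?U"
      using xs by (auto simp: seq_space_def PiE_iff)
    show "openin (discrete_topology {1..d}) (?U i)" if "i \<in> - {0}" for i
      using that seq_space_range[OF xs] by auto
    show "Pi\<^sub>E (- {0}) ?U \<subseteq> A"
    proof
      fix y assume y: "y \<in> Pi\<^sub>E (- {0}) ?U"
      have "y j \<in> {1..d}" if "j \<noteq> 0" for j
        using PiE_mem[OF y, of j] that seq_space_range[OF xs that] by (auto split: if_splits)
      then have "y \<in> seq_space d"
        using y by (auto simp: seq_space_def PiE_iff)
      moreover have "y j = x j" if "j \<in> window m" for j
        using PiE_mem[OF y, of j] that by (auto simp: window_def)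
      ultimately show "y \<in> A"
        using depends_onD[OF m, of y x] xs x by blast
    qed
  qed
qed

text \<open>Countability of the union is the point: it puts every open set into the sigma-algebra
  generated by the local sets.\<close>

lemma openin_local_union:
  assumes "openin (seq_topology d) O'"
  shows "\<exists>A::nat \<Rightarrow> _. range A \<subseteq> local_sets d \<and> O' = (\<Union>m. A m)"
proof (intro exI conjI)
  \<comment> \<open>The largest subset of \<open>O'\<close> that is determined by the window
    \<open>m\<close>. These sets exhaust \<open>O'\<close>, since a basic neighbourhood restricts
    only finitely many coordinates.\<close>
  let ?A = "\<lambda>m::nat. {x \<in> seq_space d. cylinder d (window m) x \<subseteq> O'}"
  have sub: "O' \<subseteq> seq_space d"
    using openin_subset[OF assms] by (simp add: topspace_seq_topology)
  have "?A m \<in> local_sets d" for m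
  proof -
    have "depends_on d (window m) (\<lambda>x. x \<in> ?A m)"
    proof (rule depends_onI)
      fix x y assume "x \<in> seq_space d" "y \<in> seq_space d" and eq: "\<And>j. j \<in> window m \<Longrightarrow> x j = y j"
      moreover have "cylinder d (window m) x = cylinder d (window m) y"
        using eq by (auto simp: cylinder_def)
      ultimately show "(x \<in> ?A m) = (y \<in> ?A m)" by simp
    qed
    then show ?thesis
      by (auto simp: local_sets_def local_fun_def)
  qed
  then show "range ?A \<subseteq> local_sets d" by blast
  show "O' = (\<Union>m. ?A m)"
  proof
    show "(\<Union>m. ?A m) \<subseteq> O'"
      by (auto simp: cylinder_def)
    show "O' \<subseteq> (\<Union>m. ?A m)"
    proof
      fix x assume x: "x \<in> O'"
      from assms x obtain V where V: "finite {i \<in> - {0}. V i \<noteq> {1..d}}" "x \<in> Pi\<^sub>E (- {0}) V" "Pi\<^sub>E (- {0}) V \<subseteq> O'"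
        unfolding seq_topology_def openin_product_topology_alt by auto
      let ?J = "{i \<in> - {0}. V i \<noteq> {1..d}}"
      define m where "m = nat (\<Sum>j\<in>?J. \<bar>j\<bar>)"
      have "\<bar>j\<bar> \<le> (\<Sum>j\<in>?J. \<bar>j\<bar>)" if "j \<in> ?J" for j
        using V(1) that by (intro member_le_sum) auto
      then have J: "j \<in> window m" if "j \<in> ?J" for j
        using that by (force simp: window_def m_def)
      have "cylinder d (window m) x \<subseteq> Pi\<^sub>E (- {0}) V"
      proof
        fix z assume z: "z \<in> cylinder d (window m) x"
        then have zs: "z \<in> seq_space d" by (simp add: cylinder_def)
        have "z j \<in> V j" if "j \<noteq> 0" for j
        proof (cases "j \<in> ?J")
          case True
          then have "z j = x j"
            using z J[OF True] by (simp add: cylinder_def)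
          then show ?thesis
            using PiE_mem[OF V(2), of j] that by simp
        next
          case False
          with that have "V j = {1..d}" by simp
          then show ?thesis
            using seq_space_range[OF zs that] by simp
        qed
        then show "z \<in> Pi\<^sub>E (- {0}) V"
          using zs by (auto simp: seq_space_def PiE_iff)
      qed
      then have "cylinder d (window m) x \<subseteq> O'"
        using V(3) by (rule order_trans)
      moreover have "x \<in> seq_space d"
        using x sub by (rule subsetD[rotated])
      ultimately show "x \<in> (\<Union>m. ?A m)"
        by (intro UN_I[of m]) simp_all
    qed
  qed
qed

lemma sigma_sets_local:
  "sigma_sets (seq_space d) {A. openin (seq_topology d) A} = sigma_sets (seq_space d) (local_sets d)"
proof (rule sigma_sets_eqI)
  fix A assume "A \<in> {A. openin (seq_topology d) A}"
  then have "openin (seq_topology d) A" by simp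
  from openin_local_union[OF this]
  obtain B :: "nat \<Rightarrow> _" where B: "range B \<subseteq> local_sets d" "A = (\<Union>m. B m)"
    by (elim exE conjE)
  have "B m \<in> sigma_sets (seq_space d) (local_sets d)" for m
    using B(1) by (intro sigma_sets.Basic) blast
  then show "A \<in> sigma_sets (seq_space d) (local_sets d)"
    unfolding B(2) by (rule sigma_sets.Union)
next
  fix A assume "A \<in> local_sets d"
  then show "A \<in> sigma_sets (seq_space d) {A. openin (seq_topology d) A}"
    by (intro sigma_sets.Basic) (simp add: local_sets_openin)
qed

lemma local_sets_algebra: "algebra (seq_space d) (local_sets d)"
proof -
  have "local_fun d (\<lambda>x. x \<in> A - B)" "local_fun d (\<lambda>x. x \<in> A \<union> B)"
    if "local_fun d (\<lambda>x. x \<in> A)" "local_fun d (\<lambda>x. x \<in> B)" for A B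
    using local_fun_comp2[OF that, of "\<lambda>p q. p \<and> \<not> q"] local_fun_comp2[OF that, of "(\<or>)"] by simp_all
  moreover have "local_fun d (\<lambda>x. x \<in> seq_space d)"
    unfolding local_fun_def by (auto intro!: depends_onI)
  ultimately show ?thesis
    unfolding algebra_iff_Un by (auto simp: local_sets_def local_fun_const)
qed

text \<open>Valid for arbitrary \<open>S\<close>, so a local function is continuous and Borel
  measurable into any topological space.\<close>

lemma local_fun_vimage:
  assumes "local_fun d g"
  shows "{x \<in> seq_space d. g x \<in> S} \<in> local_sets d"
proof -
  from assms obtain m where "depends_on d (window m) g"
    by (auto simp: local_fun_def)
  then have "depends_on d (window m) (\<lambda>x. x \<in> {x \<in> seq_space d. g x \<in> S})"
    unfolding depends_on_def by (metis (mono_tags, lifting) mem_Collect_eq)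
  then show ?thesis
    by (auto simp: local_sets_def local_fun_def)
qed

lemma local_fun_indicator: "A \<in> local_sets d \<Longrightarrow> local_fun d (indicator A)"
  unfolding indicator_def local_sets_def using local_fun_comp[of d "\<lambda>x. x \<in> A" "of_bool"] by simp

lemma local_fun_continuous:
  fixes g :: "(int \<Rightarrow> nat) \<Rightarrow> 'b::topological_space"
  assumes "local_fun d g"
  shows "continuous_map (seq_topology d) euclidean g"
  using local_sets_openin[OF local_fun_vimage[OF assms]]
  by (simp add: continuous_map_def topspace_seq_topology)

lemma borel_probability_space:
  assumes "borel_probability d \<alpha>"
  shows "space \<alpha> = seq_space d"
proof -
  have "sets \<alpha> = sigma_sets (seq_space d) (local_sets d)"
    using assms by (simp add: borel_probability_def sigma_sets_local)
  then have "sets \<alpha> = sets (sigma (seq_space d) (local_sets d))"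
    by (subst sets_measure_of) (auto simp: local_sets_def)
  then show ?thesis
    by (auto dest: sets_eq_imp_space_eq simp: space_measure_of_conv)
qed

lemma borel_probability_sets:
  "borel_probability d \<alpha> \<Longrightarrow> sets \<alpha> = sigma_sets (seq_space d) (local_sets d)"
  by (simp add: borel_probability_def sigma_sets_local)

lemma borel_probability_prob_space: "borel_probability d \<alpha> \<Longrightarrow> prob_space \<alpha>"
  by (simp add: borel_probability_def)

lemma local_sets_measurable: "borel_probability d \<alpha> \<Longrightarrow> A \<in> local_sets d \<Longrightarrow> A \<in> sets \<alpha>"
  by (simp add: borel_probability_sets sigma_sets.Basic)

lemma local_fun_measurable:
  fixes g :: "(int \<Rightarrow> nat) \<Rightarrow> 'b::topological_space"
  assumes "borel_probability d \<alpha>" "local_fun d g"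
  shows "g \<in> borel_measurable \<alpha>"
proof (rule measurableI)
  fix S :: "'b set"
  have "g -` S \<inter> space \<alpha> = {x \<in> seq_space d. g x \<in> S}"
    by (auto simp: borel_probability_space[OF assms(1)])
  then show "g -` S \<inter> space \<alpha> \<in> sets \<alpha>"
    using local_sets_measurable[OF assms(1) local_fun_vimage[OF assms(2)]] by simp
qed simp

lemma local_fun_integrable:
  fixes g :: "(int \<Rightarrow> nat) \<Rightarrow> 'b::{banach, second_countable_topology}"
  assumes "d \<ge> 1" "borel_probability d \<alpha>" "local_fun d g"
  shows "integrable \<alpha> g"
proof -
  interpret prob_space \<alpha>
    using assms(2) by (rule borel_probability_prob_space)
  obtain b where "\<And>x. x \<in> seq_space d \<Longrightarrow> norm (g x) \<le> b"
    using local_fun_bounded[OF assms(1,3)] by blast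
  then have "AE x in \<alpha>. norm (g x) \<le> b"
    by (intro AE_I2) (simp add: borel_probability_space[OF assms(2)])
  then show ?thesis
    by (rule integrable_const_bound) (rule local_fun_measurable[OF assms(2,3)])
qed

lemma continuous_map_measurable:
  fixes f :: "(int \<Rightarrow> nat) \<Rightarrow> 'b::topological_space"
  assumes "borel_probability d \<alpha>" "continuous_map (seq_topology d) euclidean f"
  shows "f \<in> borel_measurable \<alpha>"
proof (rule borel_measurableI)
  fix S :: "'b set" assume "open S"
  then have "openin (seq_topology d) {x \<in> seq_space d. f x \<in> S}"
    using assms(2) by (simp add: continuous_map_def topspace_seq_topology)
  moreover have "f -` S \<inter> space \<alpha> = {x \<in> seq_space d. f x \<in> S}"
    by (auto simp: borel_probability_space[OF assms(1)])
  ultimately show "f -` S \<inter> space \<alpha> \<in> sets \<alpha>"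
    using assms(1) by (simp add: borel_probability_def sigma_sets.Basic)
qed

text \<open>Local sets are stable under intersection and contain the whole space. The formulation
  with finite measures also covers the weighted measures of the Gibbs condition, whose mass need not
  be 1.\<close>

lemma measure_eqI_local:
  assumes "sets \<mu> = sigma_sets (seq_space d) (local_sets d)" "sets \<nu> = sigma_sets (seq_space d) (local_sets d)"
    and "finite_measure \<mu>"
    and "\<And>A. A \<in> local_sets d \<Longrightarrow> emeasure \<mu> A = emeasure \<nu> A"
  shows "\<mu> = \<nu>"
proof (rule measure_eqI_generator_eq[where E = "local_sets d" and \<Omega> = "seq_space d" and A = "\<lambda>_. seq_space d"])
  interpret algebra "seq_space d" "local_sets d"
    by (rule local_sets_algebra)
  show "Int_stable (local_sets d)"
    by (auto simp: Int_stable_def)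
  show "local_sets d \<subseteq> Pow (seq_space d)"
    by (rule space_closed)
  show "range (\<lambda>_. seq_space d) \<subseteq> local_sets d"
    by auto
  show "emeasure \<mu> (seq_space d) \<noteq> \<infinity>" for i :: nat
    using assms(3) by (simp add: finite_measure.emeasure_finite)
qed (use assms in auto)

lemma borel_probability_eqI:
  assumes "borel_probability d \<mu>" "borel_probability d \<nu>"
    and "\<And>A. A \<in> local_sets d \<Longrightarrow> measure \<mu> A = measure \<nu> A"
  shows "\<mu> = \<nu>"
proof (rule measure_eqI_local)
  interpret \<mu>: prob_space \<mu> using assms(1) by (rule borel_probability_prob_space)
  interpret \<nu>: prob_space \<nu> using assms(2) by (rule borel_probability_prob_space)
  show "finite_measure \<mu>" by unfold_locales
  show "emeasure \<mu> A = emeasure \<nu> A" if "A \<in> local_sets d" for A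
    using assms(3)[OF that] by (simp add: \<mu>.emeasure_eq_measure \<nu>.emeasure_eq_measure)
qed (use assms in \<open>auto simp: borel_probability_sets\<close>)

section \<open>The limiting mean\<close>

context finite_range_system
begin

abbreviation window_expec :: "nat \<Rightarrow> ((int \<Rightarrow> nat) \<Rightarrow> real) \<Rightarrow> (int \<Rightarrow> nat) \<Rightarrow> real" where
  "window_expec n \<equiv> expec (- int n) (int n)"

lemma expec_local:
  assumes "local_fun d g"
  shows "local_fun d (expec p q g)"
proof -
  from assms obtain m where m: "depends_on d (window m) g"
    by (auto simp: local_fun_def)
  obtain n where n: "seg (p - 2 * int r) (q + 2 * int r) \<subseteq> window n"
    using seg_subset_window by blast
  have "depends_on d (window (max m n)) (expec p q g)"
  proof (rule expec_depends)
    show "depends_on d (window (max m n)) g"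
      by (rule depends_on_mono[OF m window_mono]) simp
    show "seg (p - 2 * int r) (q + 2 * int r) \<subseteq> window (max m n)"
      using n window_mono[of n "max m n"] by auto
  qed
  then show ?thesis
    by (auto simp: local_fun_def)
qed

lemma window_expec_uniform:
  assumes "local_fun d g" "\<epsilon> > 0"
  obtains N where "\<And>n x y. N \<le> n \<Longrightarrow> x \<in> points \<Longrightarrow> y \<in> points
    \<Longrightarrow> \<bar>window_expec n g x - window_expec n g y\<bar> \<le> \<epsilon>"
proof -
  from assms obtain m where m: "depends_on d (window m) g"
    by (auto simp: local_fun_def)
  obtain b where b: "\<And>x. x \<in> points \<Longrightarrow> \<bar>g x\<bar> \<le> b"
    using local_fun_bounded[OF d_pos assms(1)] unfolding real_norm_def by blast
  have osc: "\<bar>g x - g y\<bar> \<le> 2 * b" if "x \<in> points" "y \<in> points" for x y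
    using b[OF that(1)] b[OF that(2)] by linarith
  have "(\<lambda>k. (1 - rate) ^ k * (2 * b)) \<longlonglongrightarrow> 0 * (2 * b)"
    using rate_pos rate_le_1 by (intro tendsto_mult LIMSEQ_power_zero tendsto_const) auto
  then have "eventually (\<lambda>k. (1 - rate) ^ k * (2 * b) < \<epsilon>) sequentially"
    using assms(2) by (intro order_tendstoD(2)) auto
  then obtain k where k: "(1 - rate) ^ k * (2 * b) < \<epsilon>"
    by (auto simp: eventually_sequentially)
  show ?thesis
  proof (rule that)
    fix n x y assume "m + 2 * r * k \<le> n" "x \<in> points" "y \<in> points"
    then have "\<bar>window_expec n g x - window_expec n g y\<bar> \<le> (1 - rate) ^ k * (2 * b)"
      by (intro expec_osc_power[OF m osc])
    with k show "\<bar>window_expec n g x - window_expec n g y\<bar> \<le> \<epsilon>" by simp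
  qed
qed

text \<open>By the tower property the expectation over the larger window is an average of values of
  the smaller one, and these differ pairwise by at most \<open>\<epsilon>\<close>.\<close>

lemma window_expec_Cauchy:
  assumes "local_fun d g" "\<epsilon> > 0"
  obtains N where "\<And>m n x y. N \<le> n \<Longrightarrow> n \<le> m \<Longrightarrow> x \<in> points \<Longrightarrow> y \<in> points
    \<Longrightarrow> \<bar>window_expec m g x - window_expec n g y\<bar> \<le> \<epsilon>"
proof -
  obtain N where N: "\<And>n x y. N \<le> n \<Longrightarrow> x \<in> points \<Longrightarrow> y \<in> points
    \<Longrightarrow> \<bar>window_expec n g x - window_expec n g y\<bar> \<le> \<epsilon>"
    using window_expec_uniform[OF assms] by blast
  show ?thesis
  proof (rule that)
    fix m n x y assume *: "N \<le> n" "n \<le> m" "x \<in> points" "y \<in> points"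
    have "window_expec n g y - \<epsilon> \<le> window_expec n g u \<and> window_expec n g u \<le> window_expec n g y + \<epsilon>"
      if "u \<in> points" for u
      using N[OF *(1) that *(4)] by (simp add: abs_le_iff)
    then have "window_expec n g y - \<epsilon> \<le> window_expec m (window_expec n g) x"
        "window_expec m (window_expec n g) x \<le> window_expec n g y + \<epsilon>"
      by (intro expec_bounds[OF *(3)]; blast)+
    moreover have "window_expec m (window_expec n g) x = window_expec m g x"
      using * by (intro expec_tower) auto
    ultimately show "\<bar>window_expec m g x - window_expec n g y\<bar> \<le> \<epsilon>"
      by (simp add: abs_le_iff)
  qed
qed

text \<open>The infinite-volume limit. The boundary condition \<open>ones\<close> is only a choice;
  the limit is the same from every point.\<close>

definition mean :: "((int \<Rightarrow> nat) \<Rightarrow> real) \<Rightarrow> real" where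
  "mean g = lim (\<lambda>n. window_expec n g ones)"

lemma window_expec_mean:
  assumes "local_fun d g" "x \<in> points"
  shows "(\<lambda>n. window_expec n g x) \<longlonglongrightarrow> mean g"
proof -
  have "Cauchy (\<lambda>n. window_expec n g ones)"
  proof (rule metric_CauchyI)
    fix e :: real assume e: "e > 0"
    obtain N where N: "\<And>m n x y. N \<le> n \<Longrightarrow> n \<le> m \<Longrightarrow> x \<in> points \<Longrightarrow> y \<in> points
      \<Longrightarrow> \<bar>window_expec m g x - window_expec n g y\<bar> \<le> e / 2"
      using window_expec_Cauchy[OF assms(1), of "e / 2"] e by auto
    have "dist (window_expec m g ones) (window_expec n g ones) < e" if "N \<le> m" "N \<le> n" for m n
      using N[of m n ones ones] N[of n m ones ones] that e
      by (cases "n \<le> m") (auto simp: dist_real_def abs_minus_commute)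
    then show "\<exists>M. \<forall>m\<ge>M. \<forall>n\<ge>M. dist (window_expec m g ones) (window_expec n g ones) < e"
      by blast
  qed
  then have lim: "(\<lambda>n. window_expec n g ones) \<longlonglongrightarrow> mean g"
    unfolding mean_def using Cauchy_convergent convergent_LIMSEQ_iff by blast
  have "(\<lambda>n. window_expec n g x - window_expec n g ones) \<longlonglongrightarrow> 0"
  proof (rule LIMSEQ_I)
    fix e :: real assume e: "e > 0"
    obtain N where "\<And>n x y. N \<le> n \<Longrightarrow> x \<in> points \<Longrightarrow> y \<in> points
      \<Longrightarrow> \<bar>window_expec n g x - window_expec n g y\<bar> \<le> e / 2"
      using window_expec_uniform[OF assms(1), of "e / 2"] e by auto
    then have "norm (window_expec n g x - window_expec n g ones - 0) < e" if "N \<le> n" for n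
      using that assms(2) e by (smt (verit) ones_in real_norm_def field_sum_of_halves)
    then show "\<exists>no. \<forall>n\<ge>no. norm (window_expec n g x - window_expec n g ones - 0) < e"
      by blast
  qed
  from tendsto_add[OF this lim] show ?thesis by simp
qed

text \<open>The larger window of the Cauchy estimate tends to infinity. Uniformity in
  \<open>x\<close> is what later permits integration against an arbitrary probability.\<close>

lemma window_expec_near_mean:
  assumes "local_fun d g" "\<epsilon> > 0"
  obtains N where "\<And>n x. N \<le> n \<Longrightarrow> x \<in> points \<Longrightarrow> \<bar>window_expec n g x - mean g\<bar> \<le> \<epsilon>"
proof -
  obtain N where N: "\<And>m n x y. N \<le> n \<Longrightarrow> n \<le> m \<Longrightarrow> x \<in> points \<Longrightarrow> y \<in> points
    \<Longrightarrow> \<bar>window_expec m g x - window_expec n g y\<bar> \<le> \<epsilon>"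
    using window_expec_Cauchy[OF assms] by blast
  show ?thesis
  proof (rule that)
    fix n x assume *: "N \<le> n" "x \<in> points"
    have "(\<lambda>m. \<bar>window_expec m g x - window_expec n g x\<bar>) \<longlonglongrightarrow> \<bar>mean g - window_expec n g x\<bar>"
      by (intro tendsto_intros window_expec_mean assms *)
    then have "\<bar>mean g - window_expec n g x\<bar> \<le> \<epsilon>"
    proof (rule tendsto_upperbound)
      show "\<forall>\<^sub>F m in sequentially. \<bar>window_expec m g x - window_expec n g x\<bar> \<le> \<epsilon>"
        using eventually_ge_at_top[of n] by eventually_elim (rule N[OF *(1) _ *(2,2)])
    qed simp
    then show "\<bar>window_expec n g x - mean g\<bar> \<le> \<epsilon>"
      by (simp add: abs_minus_commute)
  qed
qed

lemma mean_eqI: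
  assumes "local_fun d g" "(\<lambda>n. window_expec n g ones) \<longlonglongrightarrow> c"
  shows "mean g = c"
  using LIMSEQ_unique[OF window_expec_mean[OF assms(1) ones_in] assms(2)] .

lemma mean_add:
  assumes "local_fun d g" "local_fun d h"
  shows "mean (\<lambda>x. g x + h x) = mean g + mean h"
proof (rule mean_eqI)
  show "local_fun d (\<lambda>x. g x + h x)"
    by (rule local_fun_comp2[OF assms])
  show "(\<lambda>n. window_expec n (\<lambda>x. g x + h x) ones) \<longlonglongrightarrow> mean g + mean h"
    unfolding expec_add by (intro tendsto_add window_expec_mean assms ones_in)
qed

lemma mean_const: "mean (\<lambda>_. c) = c"
  by (rule mean_eqI) (auto simp: expec_const local_fun_const)

lemma mean_nonneg:
  assumes "local_fun d g" "\<And>x. x \<in> points \<Longrightarrow> g x \<ge> 0"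
  shows "mean g \<ge> 0"
proof (rule tendsto_lowerbound[OF window_expec_mean[OF assms(1) ones_in]])
  show "\<forall>\<^sub>F n in sequentially. 0 \<le> window_expec n g ones"
    unfolding expec_def using assms(2) weight_pos[OF ones_in] fiber_in_space
    by (intro always_eventually allI divide_nonneg_pos sum_nonneg mult_nonneg_nonneg) auto
qed simp

text \<open>The interval need not be symmetric: every sufficiently large window contains it, and
  there the tower property gives equality. Translation invariance and all estimates on one-sided
  cylinders rest on this freedom.\<close>

lemma mean_expec:
  assumes "local_fun d g"
  shows "mean (expec p q g) = mean g"
proof (rule mean_eqI)
  have "eventually (\<lambda>n. window_expec n g ones = window_expec n (expec p q g) ones) sequentially"
    unfolding eventually_sequentially
  proof (intro exI[of _ "nat (max \<bar>p\<bar> \<bar>q\<bar>)"] allI impI)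
    fix n assume "nat (max \<bar>p\<bar> \<bar>q\<bar>) \<le> n"
    then have "- int n \<le> p" "q \<le> int n" by auto
    then show "window_expec n g ones = window_expec n (expec p q g) ones"
      by (simp add: expec_tower)
  qed
  then show "(\<lambda>n. window_expec n (expec p q g) ones) \<longlonglongrightarrow> mean g"
    using window_expec_mean[OF assms ones_in] by (rule Lim_transform_eventually[rotated])
qed (rule expec_local[OF assms])

lemma mean_cong:
  assumes "local_fun d g" "\<And>x. x \<in> points \<Longrightarrow> g x = h x"
  shows "mean g = mean h"
proof -
  have "window_expec n g ones = window_expec n h ones" for n
    by (rule expec_cong) (rule assms(2)[OF fiber_in_space])
  then show ?thesis by (simp add: mean_def)
qed

text \<open>This is the continuity at the empty set required by Caratheodory's theorem; it is automatic
  because local sets are compact.\<close>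

lemma local_sets_decseq_empty:
  assumes "range A \<subseteq> local_sets d" "decseq A" "(\<Inter>i. A i) = {}"
  shows "\<exists>N. \<forall>n\<ge>N. A n = {}"
proof -
  interpret algebra "seq_space d" "local_sets d"
    by (rule local_sets_algebra)
  let ?C = "range (\<lambda>i. points - A i)"
  have "\<forall>V\<in>?C. openin (seq_topology d) V"
    using assms(1) by (auto intro!: local_sets_openin)
  moreover have "topspace (seq_topology d) \<subseteq> \<Union>?C"
    using assms(3) by (auto simp: topspace_seq_topology)
  ultimately obtain F where F: "finite F" "F \<subseteq> ?C" "points \<subseteq> \<Union>F"
    using compact_space_seq_topology[of d, unfolded compact_space_alt]
    unfolding topspace_seq_topology by meson
  from F(1,2) obtain I where I: "finite I" "F = (\<lambda>i. points - A i) ` I"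
    by (meson finite_subset_image)
  have "A n = {}" if "Max (insert 0 I) \<le> n" for n
  proof -
    have "A n \<subseteq> A i" if "i \<in> I" for i
    proof -
      have "i \<le> Max (insert 0 I)" using I(1) that by simp
      with \<open>Max (insert 0 I) \<le> n\<close> have "i \<le> n" by linarith
      with assms(2) show ?thesis by (rule decseqD)
    qed
    moreover have "A n \<subseteq> points"
      using assms(1) by (auto simp: local_sets_def)
    ultimately show ?thesis
      using F(3) I(2) by blast
  qed
  then show ?thesis by blast
qed

text \<open>On indicators of local sets \<open>mean\<close> is finitely additive. A decreasing
  sequence of local sets with empty intersection is eventually empty, so continuity at the empty set
  holds and Caratheodory's extension applies.\<close>

lemma exists_mean_measure:
  "\<exists>\<mu>. borel_probability d \<mu> \<and> (\<forall>A\<in>local_sets d. measure \<mu> A = mean (indicator A))"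
proof -
  interpret A: algebra "seq_space d" "local_sets d"
    by (rule local_sets_algebra)
  let ?f = "\<lambda>A. ennreal (mean (indicator A))"
  have nonneg: "mean (indicator A) \<ge> 0" if "A \<in> local_sets d" for A
    by (rule mean_nonneg[OF local_fun_indicator[OF that]]) simp
  have emp: "mean (indicator {}) = 0"
    using mean_cong[of "\<lambda>_. 0" "indicator {}"] by (simp add: mean_const local_fun_const)
  have "\<exists>\<mu>. (\<forall>s\<in>local_sets d. \<mu> s = ?f s) \<and> measure_space points (sigma_sets points (local_sets d)) \<mu>"
  proof (rule A.caratheodory_empty_continuous)
    show "positive (local_sets d) ?f"
      by (simp add: positive_def emp)
    show "additive (local_sets d) ?f"
      unfolding additive_def
    proof (intro ballI impI)
      fix A B assume AB: "A \<in> local_sets d" "B \<in> local_sets d" "A \<inter> B = {}"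
      have "mean (indicator (A \<union> B)) = mean (\<lambda>x. indicator A x + indicator B x)"
        using AB(3) by (simp add: indicator_add)
      also have "\<dots> = mean (indicator A) + mean (indicator B)"
        using AB by (intro mean_add local_fun_indicator)
      finally show "?f (A \<union> B) = ?f A + ?f B"
        using nonneg AB by simp
    qed
    show "(\<lambda>i. ?f (A i)) \<longlonglongrightarrow> 0"
      if A: "range A \<subseteq> local_sets d" "decseq A" "(\<Inter>i. A i) = {}" for A :: "nat \<Rightarrow> _"
    proof -
      obtain N where N: "\<forall>n\<ge>N. A n = {}"
        using local_sets_decseq_empty[OF A] by blast
      have "eventually (\<lambda>n. 0 = ?f (A n)) sequentially"
        using eventually_ge_at_top[of N] by eventually_elim (simp add: N emp)
      then show ?thesis
        by (rule Lim_transform_eventually[rotated]) simp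
    qed
  qed simp
  then obtain \<nu> where \<nu>: "\<And>A. A \<in> local_sets d \<Longrightarrow> \<nu> A = ?f A"
    "measure_space points (sigma_sets points (local_sets d)) \<nu>"
    by blast
  define \<mu> where "\<mu> = measure_of points (local_sets d) \<nu>"
  have em: "emeasure \<mu> A = ?f A" if "A \<in> local_sets d" for A
    unfolding \<mu>_def emeasure_measure_of_conv using that \<nu> by (simp add: sigma_sets.Basic)
  have sets: "sets \<mu> = sigma_sets points (local_sets d)"
    unfolding \<mu>_def by (rule sets_measure_of[OF A.space_closed])
  have space: "space \<mu> = points"
    unfolding \<mu>_def by (rule space_measure_of[OF A.space_closed])
  have "mean (indicator points) = mean (\<lambda>_. 1)"
    by (rule mean_cong) (auto intro: local_fun_indicator)
  then have "emeasure \<mu> (space \<mu>) = 1"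
    using em[OF A.top] by (simp add: space mean_const)
  then have "borel_probability d \<mu>"
    by (simp add: borel_probability_def sets sigma_sets_local prob_spaceI)
  then show ?thesis
    using em nonneg by (auto simp: measure_def)
qed

end

section \<open>Gibbs probabilities\<close>

lemma zero_notin_window [simp]: "0 \<notin> window n"
  by (simp add: window_def)

lemma finite_window [simp]: "finite (window n)"
  by (simp add: window_def)

lemma replace_window_in [simp]:
  assumes "b \<in> window n \<rightarrow>\<^sub>E {1..d}" "z \<in> seq_space d"
  shows "replace_window n b z \<in> seq_space d"
proof -
  have "b j \<in> {1..d}" if "j \<in> window n" for j
    using PiE_mem[OF assms(1) that] .
  moreover have "z j \<in> {1..d}" if "j \<noteq> 0" for j
    by (rule seq_space_range[OF assms(2) that])
  ultimately have "replace_window n b z j \<in> {1..d}" if "j \<noteq> 0" for j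
    using that by (auto simp: replace_window_def)
  moreover have "replace_window n b z 0 = undefined"
    using assms(2) by (simp add: replace_window_def seq_space_0)
  ultimately show ?thesis
    by (simp add: seq_space_mem)
qed

lemma replace_window_fiber:
  "b \<in> window n \<rightarrow>\<^sub>E {1..d} \<Longrightarrow> z \<in> seq_space d \<Longrightarrow> replace_window n b z \<in> fiber d (window n) z"
  using replace_window_in[of b n d z] by (simp add: fiber_def) (simp add: replace_window_def)

lemma replace_window_twice [simp]: "replace_window n a (replace_window n b z) = replace_window n a z"
  by (auto simp: replace_window_def)

lemma replace_window_id: "z \<in> cylinder d (window n) a \<Longrightarrow> replace_window n a z = z"
  by (auto simp: replace_window_def cylinder_def)

lemma replace_window_mem_cylinder:
  assumes "a \<in> window n \<rightarrow>\<^sub>E {1..d}" "b \<in> window n \<rightarrow>\<^sub>E {1..d}" "z \<in> seq_space d"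
  shows "replace_window n b z \<in> cylinder d (window n) a \<longleftrightarrow> b = a"
proof
  assume *: "replace_window n b z \<in> cylinder d (window n) a"
  show "b = a"
  proof (rule PiE_ext[OF assms(2,1)])
    fix j assume "j \<in> window n"
    with * show "b j = a j"
      by (simp add: cylinder_def replace_window_def)
  qed
next
  assume "b = a"
  then show "replace_window n b z \<in> cylinder d (window n) a"
    using replace_window_in[OF assms(2,3)] by (simp add: cylinder_def replace_window_def)
qed

text \<open>Translates between the two descriptions of a finite volume: words and replacement maps
  in the Gibbs condition, fibers in the conditional expectations.\<close>

lemma bij_betw_replace_window:
  assumes "z \<in> seq_space d"
  shows "bij_betw (\<lambda>b. replace_window n b z) (window n \<rightarrow>\<^sub>E {1..d}) (fiber d (window n) z)"
proof (rule bij_betw_byWitness[where f' = "\<lambda>y. restrict y (window n)"])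
  show "\<forall>b\<in>window n \<rightarrow>\<^sub>E {1..d}. restrict (replace_window n b z) (window n) = b"
    by (auto simp: replace_window_def restrict_def PiE_iff extensional_def)
  show "\<forall>y\<in>fiber d (window n) z. replace_window n (restrict y (window n)) z = y"
    by (auto simp: replace_window_def fiber_def)
  show "(\<lambda>b. replace_window n b z) ` (window n \<rightarrow>\<^sub>E {1..d}) \<subseteq> fiber d (window n) z"
    by (intro image_subsetI replace_window_fiber assms)
  show "(\<lambda>y. restrict y (window n)) ` fiber d (window n) z \<subseteq> window n \<rightarrow>\<^sub>E {1..d}"
  proof (rule image_subsetI)
    fix y assume "y \<in> fiber d (window n) z"
    then have "y \<in> seq_space d" by (rule fiber_in_space)
    then have "y j \<in> {1..d}" if "j \<in> window n" for j
      using that by (intro seq_space_range) (auto simp: window_def)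
    then show "restrict y (window n) \<in> window n \<rightarrow>\<^sub>E {1..d}"
      unfolding restrict_PiE_iff by blast
  qed
qed

lemma finite_words [simp]: "finite S \<Longrightarrow> finite (window n \<rightarrow>\<^sub>E S)"
  by (intro finite_PiE) auto

text \<open>The cylinders of the words partition the space; this splits an integral according to the
  word that is about to be replaced.\<close>

lemma sum_indicator_cylinder:
  fixes c :: real
  assumes "z \<in> seq_space d"
  shows "(\<Sum>a\<in>window n \<rightarrow>\<^sub>E {1..d}. indicator (cylinder d (window n) a) z * c) = c"
proof -
  have z: "restrict z (window n) \<in> window n \<rightarrow>\<^sub>E {1..d}"
    unfolding restrict_PiE_iff using seq_space_range[OF assms] zero_notin_window by metis
  have "indicator (cylinder d (window n) a) z * c = (if a = restrict z (window n) then c else 0)"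
    if a: "a \<in> window n \<rightarrow>\<^sub>E {1..d}" for a
  proof -
    have "z \<in> cylinder d (window n) a \<longleftrightarrow> a = restrict z (window n)"
      using assms a by (auto simp: cylinder_def restrict_def PiE_iff extensional_def)
    then show ?thesis by (simp add: indicator_def)
  qed
  then show ?thesis
    using z by simp
qed

lemma local_fun_replace_window:
  assumes "local_fun d g" "b \<in> window n \<rightarrow>\<^sub>E {1..d}"
  shows "local_fun d (\<lambda>z. g (replace_window n b z))"
proof -
  from assms(1) obtain m where m: "depends_on d (window m) g"
    by (auto simp: local_fun_def)
  have "depends_on d (window m) (\<lambda>z. g (replace_window n b z))"
  proof (rule depends_onI)
    fix x y assume "x \<in> seq_space d" "y \<in> seq_space d" "\<And>j. j \<in> window m \<Longrightarrow> x j = y j"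
    then show "g (replace_window n b x) = g (replace_window n b y)"
      by (intro depends_onD[OF m] replace_window_in assms(2)) (simp_all add: replace_window_def)
  qed
  then show ?thesis
    unfolding local_fun_def by (rule exI)
qed

text \<open>Preimages need to be checked on generators only. Used for the shift and for the
  replacement maps.\<close>

lemma measurable_local:
  assumes "borel_probability d \<alpha>" "sets N = sigma_sets (seq_space d) (local_sets d)"
    and T: "\<And>z. z \<in> seq_space d \<Longrightarrow> T z \<in> seq_space d"
    and loc: "\<And>A. A \<in> local_sets d \<Longrightarrow> local_fun d (\<lambda>z. T z \<in> A)"
  shows "T \<in> measurable \<alpha> N"
proof (rule measurable_sigma_sets[OF assms(2)])
  show "local_sets d \<subseteq> Pow (seq_space d)"
    by (auto simp: local_sets_def)
  show "T \<in> space \<alpha> \<rightarrow> seq_space d"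
    using T by (simp add: borel_probability_space[OF assms(1)])
  fix A assume "A \<in> local_sets d"
  then have "{z \<in> seq_space d. (T z \<in> A) \<in> {True}} \<in> local_sets d"
    by (intro local_fun_vimage loc)
  moreover have "T -` A \<inter> space \<alpha> = {z \<in> seq_space d. (T z \<in> A) \<in> {True}}"
    by (auto simp: borel_probability_space[OF assms(1)])
  ultimately show "T -` A \<inter> space \<alpha> \<in> sets \<alpha>"
    using local_sets_measurable[OF assms(1)] by simp
qed

lemma integral_double_sum:
  fixes f :: "'i \<Rightarrow> 'j \<Rightarrow> 'a \<Rightarrow> real"
  assumes "\<And>i j. i \<in> I \<Longrightarrow> j \<in> J \<Longrightarrow> integrable M (f i j)"
  shows "(LINT z|M. (\<Sum>i\<in>I. \<Sum>j\<in>J. f i j z)) = (\<Sum>i\<in>I. \<Sum>j\<in>J. LINT z|M. f i j z)"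
proof -
  have "(LINT z|M. (\<Sum>i\<in>I. \<Sum>j\<in>J. f i j z)) = (\<Sum>i\<in>I. LINT z|M. (\<Sum>j\<in>J. f i j z))"
    by (intro Bochner_Integration.integral_sum Bochner_Integration.integrable_sum assms)
  also have "\<dots> = (\<Sum>i\<in>I. \<Sum>j\<in>J. LINT z|M. f i j z)"
    by (intro sum.cong refl Bochner_Integration.integral_sum assms)
  finally show ?thesis .
qed

context finite_range_system
begin

abbreviation words :: "nat \<Rightarrow> (int \<Rightarrow> nat) set" where
  "words n \<equiv> window n \<rightarrow>\<^sub>E {1..d}"

abbreviation window_energy :: "nat \<Rightarrow> (int \<Rightarrow> nat) \<Rightarrow> real" where
  "window_energy n \<equiv> energy (- int n) (int n)"

abbreviation window_weight :: "nat \<Rightarrow> (int \<Rightarrow> nat) \<Rightarrow> real" where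
  "window_weight n \<equiv> weight (- int n) (int n)"

lemma energy_local: "local_fun d (energy p q)"
proof (rule depends_on_seg_local)
  show "depends_on d (seg (p - 2 * int r) (q + 2 * int r)) (energy p q)"
    by (rule depends_onI) (rule energy_cong)
qed

lemma window_weight_eq:
  "z \<in> points \<Longrightarrow> window_weight n z = (\<Sum>b\<in>words n. exp (window_energy n (replace_window n b z)))"
  unfolding weight_def window_eq_seg[symmetric]
  by (rule sum.reindex_bij_betw[OF bij_betw_replace_window, symmetric])

lemma window_expec_eq:
  "z \<in> points \<Longrightarrow> window_expec n g z =
    (\<Sum>b\<in>words n. exp (window_energy n (replace_window n b z)) * g (replace_window n b z)) / window_weight n z"
  unfolding expec_def window_eq_seg[symmetric]
  by (subst sum.reindex_bij_betw[OF bij_betw_replace_window]) auto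

lemma weight_local: "local_fun d (window_weight n)"
proof (rule local_fun_cong)
  show "local_fun d (\<lambda>z. \<Sum>b\<in>words n. exp (window_energy n (replace_window n b z)))"
    by (intro local_fun_sum local_fun_exp local_fun_replace_window[OF energy_local])
qed (simp add: window_weight_eq)

lemma cocycle_replace:
  assumes "z \<in> points" "b \<in> words n"
  shows "cocycle d U z (replace_window n b z) = window_energy n z - window_energy n (replace_window n b z)"
  using replace_window_fiber[OF assms(2,1)] by (intro cocycle_eq assms(1)) (simp add: window_eq_seg)

text \<open>The density factor of the conjugating map, extended by 0 off its domain. Its locality is
  invisible in the infinite sum and comes from \<open>cocycle_replace\<close>.\<close>

definition jacobian :: "nat \<Rightarrow> (int \<Rightarrow> nat) \<Rightarrow> (int \<Rightarrow> nat) \<Rightarrow> (int \<Rightarrow> nat) \<Rightarrow> real" where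
  "jacobian n a b z = indicator (cylinder d (window n) a) z * exp (- cocycle d U z (replace_window n b z))"

lemma jacobian_nonneg: "jacobian n a b z \<ge> 0"
  by (simp add: jacobian_def)

lemma cylinder_indicator_local:
  "local_fun d (indicator (cylinder d (window n) a) :: _ \<Rightarrow> real)"
  by (intro local_fun_indicator cylinder_local) auto

lemma jacobian_local:
  assumes "b \<in> words n"
  shows "local_fun d (jacobian n a b)"
proof (rule local_fun_cong)
  show "local_fun d (\<lambda>z. indicator (cylinder d (window n) a) z
      * exp (- (window_energy n z - window_energy n (replace_window n b z))))"
    using assms
    by (intro local_fun_mult local_fun_exp local_fun_uminus local_fun_diff
        local_fun_replace_window[OF energy_local] energy_local cylinder_indicator_local)
qed (simp add: jacobian_def cocycle_replace[OF _ assms])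

text \<open>With real local test functions, both sides are integrals of local functions and can be
  compared with \<open>mean\<close>.\<close>

definition local_gibbs :: "(int \<Rightarrow> nat) measure \<Rightarrow> bool" where
  "local_gibbs \<alpha> \<longleftrightarrow> (\<forall>n\<ge>1. \<forall>a\<in>words n. \<forall>b\<in>words n. \<forall>g. local_fun d g \<longrightarrow>
     (LINT z|\<alpha>. jacobian n a b z * g (replace_window n b z))
     = (LINT z|\<alpha>. indicator (cylinder d (window n) b) z * g z))"

lemma gibbs_imp_local_gibbs:
  assumes "c_star_gibbs d U \<alpha>"
  shows "local_gibbs \<alpha>"
  unfolding local_gibbs_def
proof (intro allI impI ballI)
  fix n a b and g :: "(int \<Rightarrow> nat) \<Rightarrow> real"
  assume n: "n \<ge> 1" and ab: "a \<in> words n" "b \<in> words n" and g: "local_fun d g"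
  have "continuous_map (seq_topology d) euclidean (\<lambda>z. complex_of_real (g z))"
    by (rule local_fun_continuous[OF local_fun_comp[OF g]])
  with assms n ab have
    "(LINT z:cylinder d (window n) a|\<alpha>. of_real (exp (- cocycle d U z (replace_window n b z)))
        * complex_of_real (g (replace_window n b z)))
      = (LINT z:cylinder d (window n) b|\<alpha>. complex_of_real (g z))"
    unfolding c_star_gibbs_def by blast
  then have "complex_of_real (LINT z|\<alpha>. jacobian n a b z * g (replace_window n b z))
      = complex_of_real (LINT z|\<alpha>. indicator (cylinder d (window n) b) z * g z)"
    unfolding set_lebesgue_integral_def scaleR_conv_of_real of_real_mult[symmetric]
      integral_complex_of_real jacobian_def by (simp add: mult.assoc)
  then show "(LINT z|\<alpha>. jacobian n a b z * g (replace_window n b z))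
      = (LINT z|\<alpha>. indicator (cylinder d (window n) b) z * g z)"
    by (simp only: of_real_eq_iff)
qed

text \<open>No approximation of \<open>f\<close> by local functions is made. Both sides are
  integrals of \<open>f\<close> against finite measures, the image of the Jacobian density and the
  restriction to the target cylinder, and these measures agree on local sets.\<close>

lemma local_gibbs_imp_gibbs:
  assumes \<alpha>: "borel_probability d \<alpha>" and "local_gibbs \<alpha>"
  shows "c_star_gibbs d U \<alpha>"
  unfolding c_star_gibbs_def
proof (intro allI impI ballI)
  fix n a b and f :: "(int \<Rightarrow> nat) \<Rightarrow> complex"
  assume n: "n \<ge> 1" and ab: "a \<in> words n" "b \<in> words n" and f: "continuous_map (seq_topology d) euclidean f"
  interpret prob_space \<alpha>
    using \<alpha> by (rule borel_probability_prob_space)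
  let ?T = "replace_window n b"
  let ?w = "jacobian n a b" and ?v = "indicator (cylinder d (window n) b) :: _ \<Rightarrow> real"
  have [measurable]: "f \<in> borel_measurable \<alpha>"
    by (rule continuous_map_measurable[OF \<alpha> f])
  have [measurable]: "?w \<in> borel_measurable \<alpha>" "?v \<in> borel_measurable \<alpha>"
    by (intro local_fun_measurable[OF \<alpha>] jacobian_local ab cylinder_indicator_local)+
  have T: "local_fun d (\<lambda>z. ?T z \<in> A)" if "A \<in> local_sets d" for A
    using that ab(2) by (intro local_fun_replace_window) (auto simp: local_sets_def)
  have [measurable]: "?T \<in> measurable \<alpha> \<alpha>"
    using ab by (intro measurable_local[OF \<alpha> borel_probability_sets[OF \<alpha>]] T) auto
  have pts: "space \<alpha> = points"
    by (rule borel_probability_space[OF \<alpha>])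
  define \<nu> where "\<nu> = distr (density \<alpha> ?w) \<alpha> ?T"
  define \<nu>' where "\<nu>' = density \<alpha> ?v"
  have eq: "emeasure \<nu> A = emeasure \<nu>' A" if A: "A \<in> local_sets d" for A
  proof -
    have [measurable]: "A \<in> sets \<alpha>"
      using A by (rule local_sets_measurable[OF \<alpha>])
    have ind: "local_fun d (indicator A :: _ \<Rightarrow> real)"
      by (rule local_fun_indicator[OF A])
    have "emeasure \<nu> A = emeasure (density \<alpha> ?w) (?T -` A \<inter> space \<alpha>)"
      unfolding \<nu>_def by (subst emeasure_distr) auto
    also have "\<dots> = (\<integral>\<^sup>+ z. ennreal (?w z) * indicator (?T -` A \<inter> space \<alpha>) z \<partial>\<alpha>)"
      by (rule emeasure_density) auto
    also have "\<dots> = (\<integral>\<^sup>+ z. ennreal (?w z * indicator A (?T z)) \<partial>\<alpha>)"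
      by (intro nn_integral_cong) (auto simp: indicator_def)
    also have "\<dots> = ennreal (LINT z|\<alpha>. ?w z * indicator A (?T z))"
      by (intro nn_integral_eq_integral local_fun_integrable[OF d_pos \<alpha>]
          local_fun_mult jacobian_local local_fun_replace_window[OF ind] ab AE_I2)
        (simp add: jacobian_nonneg)
    also have "(LINT z|\<alpha>. ?w z * indicator A (?T z)) = (LINT z|\<alpha>. ?v z * indicator A z)"
      using assms(2) n ab ind unfolding local_gibbs_def by blast
    also have "ennreal \<dots> = (\<integral>\<^sup>+ z. ennreal (?v z * indicator A z) \<partial>\<alpha>)"
      by (intro nn_integral_eq_integral[symmetric] local_fun_integrable[OF d_pos \<alpha>]
          local_fun_mult cylinder_indicator_local ind AE_I2) simp
    also have "\<dots> = (\<integral>\<^sup>+ z. ennreal (?v z) * indicator A z \<partial>\<alpha>)"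
      by (intro nn_integral_cong) (auto simp: indicator_def)
    also have "\<dots> = emeasure \<nu>' A"
      unfolding \<nu>'_def by (rule emeasure_density[symmetric]) auto
    finally show ?thesis .
  qed
  have "\<nu> = \<nu>'"
  proof (rule measure_eqI_local[OF _ _ _ eq])
    show "sets \<nu> = sigma_sets points (local_sets d)" "sets \<nu>' = sigma_sets points (local_sets d)"
      by (simp_all add: \<nu>_def \<nu>'_def borel_probability_sets[OF \<alpha>])
    interpret A: algebra points "local_sets d"
      by (rule local_sets_algebra)
    \<comment> \<open>Finiteness is read off from \<open>\<nu>'\<close>, whose density is at most 1,
      so no bound on the Jacobian is required.\<close>
    have "emeasure \<nu> (space \<nu>) = emeasure \<nu>' points"
      using eq[OF A.top] by (simp add: \<nu>_def pts)
    also have "\<dots> = (\<integral>\<^sup>+ z. ennreal (?v z) * indicator (space \<alpha>) z \<partial>\<alpha>)"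
      unfolding \<nu>'_def pts[symmetric] by (rule emeasure_density) auto
    also have "\<dots> \<le> (\<integral>\<^sup>+ z. 1 \<partial>\<alpha>)"
      by (intro nn_integral_mono) (auto simp: indicator_def)
    also have "\<dots> = 1"
      by (simp add: emeasure_space_1)
    finally show "finite_measure \<nu>"
      by (intro finite_measureI) (auto simp: top_unique)
  qed
  then have "integral\<^sup>L \<nu> f = integral\<^sup>L \<nu>' f" by simp
  moreover have "integral\<^sup>L \<nu> f = (LINT z|\<alpha>. ?w z *\<^sub>R f (?T z))"
    unfolding \<nu>_def by (subst integral_distr; (subst integral_density)?) (auto simp: jacobian_nonneg)
  moreover have "integral\<^sup>L \<nu>' f = (LINT z|\<alpha>. ?v z *\<^sub>R f z)"
    unfolding \<nu>'_def by (rule integral_density) auto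
  ultimately show "(LINT z:cylinder d (window n) a|\<alpha>. of_real (exp (- cocycle d U z (?T z))) * f (?T z))
      = (LINT z:cylinder d (window n) b|\<alpha>. f z)"
    by (simp add: set_lebesgue_integral_def jacobian_def scaleR_conv_of_real mult.assoc)
qed

text \<open>These are the DLR equations. The integral is split by the present word \<open>a\<close>
  and the replacing word \<open>b\<close>; the Gibbs condition moves each piece from the cylinder of
  \<open>a\<close> to that of \<open>b\<close>.\<close>

lemma local_gibbs_window_expec:
  assumes \<alpha>: "borel_probability d \<alpha>" and "local_gibbs \<alpha>" and n: "n \<ge> 1" and g: "local_fun d g"
  shows "(LINT z|\<alpha>. window_expec n g z) = (LINT z|\<alpha>. g z)"
proof -
  have pts: "space \<alpha> = points"
    by (rule borel_probability_space[OF \<alpha>])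
  let ?cyl = "\<lambda>a. indicator (cylinder d (window n) a) :: _ \<Rightarrow> real"
  let ?e = "\<lambda>b z. exp (window_energy n (replace_window n b z))"
  \<comment> \<open>The energy of \<open>a\<close> is stored in the test function. On the cylinder
    of \<open>a\<close> the Jacobian exchanges it for the energy of \<open>b\<close>, and the
    partition function is constant on the fiber.\<close>
  let ?G = "\<lambda>a z. ?e a z * g z / window_weight n z"
  have locG: "local_fun d (?G a)" if "a \<in> words n" for a
    using that
    by (intro local_fun_divide local_fun_mult local_fun_exp weight_local g
        local_fun_replace_window[OF energy_local])
  have step: "(LINT z|\<alpha>. ?cyl a z * (?e b z * g (replace_window n b z) / window_weight n z))
      = (LINT z|\<alpha>. ?cyl b z * ?G a z)" if ab: "a \<in> words n" "b \<in> words n" for a b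
  proof -
    have "(LINT z|\<alpha>. ?cyl a z * (?e b z * g (replace_window n b z) / window_weight n z))
       = (LINT z|\<alpha>. jacobian n a b z * ?G a (replace_window n b z))"
    proof (rule Bochner_Integration.integral_cong)
      fix z assume "z \<in> space \<alpha>"
      then have z: "z \<in> points" by (simp add: pts)
      show "?cyl a z * (?e b z * g (replace_window n b z) / window_weight n z)
          = jacobian n a b z * ?G a (replace_window n b z)"
      proof (cases "z \<in> cylinder d (window n) a")
        case True
        have "window_weight n (replace_window n b z) = window_weight n z"
          using replace_window_fiber[OF ab(2) z] by (intro weight_fiber) (simp add: window_eq_seg)
        moreover have "exp (- cocycle d U z (replace_window n b z)) * exp (window_energy n z) = ?e b z"
          by (simp add: cocycle_replace[OF z ab(2)] flip: exp_add)
        ultimately show ?thesis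
          using True by (simp add: jacobian_def replace_window_id flip: mult.assoc)
      qed (simp add: jacobian_def)
    qed simp
    also have "\<dots> = (LINT z|\<alpha>. ?cyl b z * ?G a z)"
      using assms(2) n ab locG[OF ab(1)] unfolding local_gibbs_def by blast
    finally show ?thesis .
  qed
  note int = local_fun_integrable[OF d_pos \<alpha>]
  have int1: "integrable \<alpha> (\<lambda>z. ?cyl a z * (?e b z * g (replace_window n b z) / window_weight n z))"
    if "a \<in> words n" "b \<in> words n" for a b
    using that
    by (intro int local_fun_divide local_fun_mult local_fun_exp cylinder_indicator_local weight_local
        local_fun_replace_window[OF g] local_fun_replace_window[OF energy_local])
  have int2: "integrable \<alpha> (\<lambda>z. ?cyl b z * ?G a z)" if "a \<in> words n" for a b
    using that by (intro int local_fun_mult cylinder_indicator_local locG)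
  have "(LINT z|\<alpha>. window_expec n g z)
      = (LINT z|\<alpha>. (\<Sum>a\<in>words n. \<Sum>b\<in>words n. ?cyl a z * (?e b z * g (replace_window n b z) / window_weight n z)))"
  proof (rule Bochner_Integration.integral_cong)
    fix z assume "z \<in> space \<alpha>"
    then have z: "z \<in> points" by (simp add: pts)
    have "window_expec n g z = (\<Sum>b\<in>words n. ?e b z * g (replace_window n b z) / window_weight n z)"
      by (simp only: window_expec_eq[OF z] sum_divide_distrib)
    then show "window_expec n g z
      = (\<Sum>a\<in>words n. \<Sum>b\<in>words n. ?cyl a z * (?e b z * g (replace_window n b z) / window_weight n z))"
      by (simp only: sum_distrib_left[symmetric] sum_indicator_cylinder[OF z])
  qed simp
  also have "\<dots> = (\<Sum>a\<in>words n. \<Sum>b\<in>words n. LINT z|\<alpha>. ?cyl b z * ?G a z)"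
    by (subst integral_double_sum) (intro int1 sum.cong refl step; assumption)+
  also have "\<dots> = (LINT z|\<alpha>. (\<Sum>a\<in>words n. \<Sum>b\<in>words n. ?cyl b z * ?G a z))"
    by (rule integral_double_sum[symmetric]) (rule int2)
  also have "\<dots> = (LINT z|\<alpha>. g z)"
  proof (rule Bochner_Integration.integral_cong)
    fix z assume "z \<in> space \<alpha>"
    then have z: "z \<in> points" by (simp add: pts)
    \<comment> \<open>Now the cylinder index is \<open>b\<close>; the sum over \<open>a\<close>
      rebuilds the partition function and cancels the denominator.\<close>
    have "(\<Sum>a\<in>words n. \<Sum>b\<in>words n. ?cyl b z * ?G a z) = (\<Sum>a\<in>words n. ?e a z) * g z / window_weight n z"
      by (simp only: sum_indicator_cylinder[OF z] sum_distrib_right sum_divide_distrib)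
    then show "(\<Sum>a\<in>words n. \<Sum>b\<in>words n. ?cyl b z * ?G a z) = g z"
      using weight_pos[OF z, of "- int n" "int n"] by (simp add: window_weight_eq[OF z])
  qed simp
  finally show ?thesis .
qed

lemma integral_eq_meanI:
  assumes \<alpha>: "borel_probability d \<alpha>" and g: "local_fun d g"
    and dlr: "\<And>n. n \<ge> 1 \<Longrightarrow> (LINT z|\<alpha>. window_expec n g z) = (LINT z|\<alpha>. g z)"
  shows "(LINT z|\<alpha>. g z) = mean g"
proof -
  interpret prob_space \<alpha>
    using \<alpha> by (rule borel_probability_prob_space)
  have "\<bar>(LINT z|\<alpha>. g z) - mean g\<bar> \<le> \<epsilon>" if \<epsilon>: "\<epsilon> > 0" for \<epsilon>
  proof -
    obtain N where N: "\<And>n x. N \<le> n \<Longrightarrow> x \<in> points \<Longrightarrow> \<bar>window_expec n g x - mean g\<bar> \<le> \<epsilon>"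
      using window_expec_near_mean[OF g \<epsilon>] by blast
    \<comment> \<open>\<open>Suc N\<close> because the hypothesis is available for
      \<open>n \<ge> 1\<close> only.\<close>
    let ?h = "window_expec (Suc N) g"
    have int: "integrable \<alpha> ?h"
      by (rule local_fun_integrable[OF d_pos \<alpha> expec_local[OF g]])
    have b: "mean g - \<epsilon> \<le> ?h x \<and> ?h x \<le> mean g + \<epsilon>" if "x \<in> space \<alpha>" for x
      using N[of "Suc N" x] that by (simp add: borel_probability_space[OF \<alpha>] abs_le_iff)
    have "mean g - \<epsilon> \<le> integral\<^sup>L \<alpha> ?h"
      using b by (intro integral_ge_const[OF int] AE_I2) blast
    moreover have "integral\<^sup>L \<alpha> ?h \<le> mean g + \<epsilon>"
      using b by (intro integral_le_const[OF int] AE_I2) blast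
    ultimately show ?thesis
      using dlr[of "Suc N"] by (simp add: abs_le_iff)
  qed
  then have "\<bar>(LINT z|\<alpha>. g z) - mean g\<bar> \<le> 0"
    by (rule field_le_epsilon) simp
  then show ?thesis by simp
qed

text \<open>In the sum over a fiber the left function survives only at the word \<open>a\<close> and
  the right one only at \<open>b\<close>, and the cocycle turns the weight of \<open>a\<close> into
  that of \<open>b\<close>. So already the window expectations agree, and \<open>mean\<close> does
  not notice the averaging.\<close>

lemma mean_jacobian:
  assumes ab: "a \<in> words n" "b \<in> words n" and g: "local_fun d g"
  shows "mean (\<lambda>z. jacobian n a b z * g (replace_window n b z))
    = mean (\<lambda>z. indicator (cylinder d (window n) b) z * g z)" (is "mean ?l = mean ?r")
proof -
  have loc: "local_fun d ?l" "local_fun d ?r"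
    by (intro local_fun_mult jacobian_local cylinder_indicator_local local_fun_replace_window[OF g] g ab)+
  have "window_expec n ?l z = window_expec n ?r z" if z: "z \<in> points" for z
  proof -
    let ?e = "\<lambda>c. exp (window_energy n (replace_window n c z))"
    have "(\<Sum>c\<in>words n. ?e c * ?l (replace_window n c z))
        = (\<Sum>c\<in>words n. if c = a then ?e b * g (replace_window n b z) else 0)"
    proof (rule sum.cong)
      fix c assume c: "c \<in> words n"
      have "?e a * exp (- cocycle d U (replace_window n a z) (replace_window n b z)) = ?e b"
        using cocycle_replace[of "replace_window n a z" b n] z ab by (simp flip: exp_add)
      then show "?e c * ?l (replace_window n c z) = (if c = a then ?e b * g (replace_window n b z) else 0)"
        using replace_window_mem_cylinder[OF ab(1) c z]
        by (auto simp: jacobian_def simp flip: mult.assoc)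
    qed simp
    also have "\<dots> = (\<Sum>c\<in>words n. if c = b then ?e b * g (replace_window n b z) else 0)"
      using ab by simp
    also have "\<dots> = (\<Sum>c\<in>words n. ?e c * ?r (replace_window n c z))"
      using replace_window_mem_cylinder[OF ab(2) _ z] by (intro sum.cong) auto
    finally show ?thesis
      by (simp add: window_expec_eq[OF z])
  qed
  then have "mean (window_expec n ?l) = mean (window_expec n ?r)"
    by (intro mean_cong expec_local loc)
  then show ?thesis
    by (simp add: mean_expec loc)
qed

theorem gibbs_iff_mean:
  assumes \<alpha>: "borel_probability d \<alpha>"
  shows "c_star_gibbs d U \<alpha> \<longleftrightarrow> (\<forall>g. local_fun d g \<longrightarrow> (LINT z|\<alpha>. g z) = mean g)"
proof
  assume "c_star_gibbs d U \<alpha>"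
  then show "\<forall>g. local_fun d g \<longrightarrow> (LINT z|\<alpha>. g z) = mean g"
    using integral_eq_meanI[OF \<alpha>] local_gibbs_window_expec[OF \<alpha> gibbs_imp_local_gibbs] by blast
next
  assume mean: "\<forall>g. local_fun d g \<longrightarrow> (LINT z|\<alpha>. g z) = mean g"
  have "local_gibbs \<alpha>"
    unfolding local_gibbs_def
  proof (intro allI impI ballI)
    fix n a b and g :: "(int \<Rightarrow> nat) \<Rightarrow> real"
    assume ab: "a \<in> words n" "b \<in> words n" and g: "local_fun d g"
    have "local_fun d (\<lambda>z. jacobian n a b z * g (replace_window n b z))"
      by (intro local_fun_mult jacobian_local local_fun_replace_window[OF g] ab)
    moreover have "local_fun d (\<lambda>z. indicator (cylinder d (window n) b) z * g z)"
      by (intro local_fun_mult cylinder_indicator_local g)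
    ultimately show "(LINT z|\<alpha>. jacobian n a b z * g (replace_window n b z))
      = (LINT z|\<alpha>. indicator (cylinder d (window n) b) z * g z)"
      using mean mean_jacobian[OF ab g] by simp
  qed
  then show "c_star_gibbs d U \<alpha>"
    by (rule local_gibbs_imp_gibbs[OF \<alpha>])
qed

end

section \<open>Equilibrium probabilities\<close>

text \<open>A two-sided form of Fekete's lemma. Expanding \<open>a (t * s)\<close> once as
  \<open>t\<close> blocks and once as \<open>s\<close> blocks shows that every lower quotient is
  below every upper quotient; \<open>P\<close> is the supremum of the lower ones.\<close>

lemma almost_additive:
  fixes a :: "nat \<Rightarrow> real"
  assumes "\<And>s t. \<bar>a (s + t) - a s - a t\<bar> \<le> L"
  shows "\<exists>P. \<forall>s. \<bar>a s - real s * P\<bar> \<le> L"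
proof -
  have mult: "\<bar>a (Suc n * s) - real (Suc n) * a s\<bar> \<le> real n * L" for n s
  proof (induction n)
    case (Suc n)
    have "\<bar>a (Suc (Suc n) * s) - a s - a (Suc n * s)\<bar> \<le> L"
      using assms[of s "Suc n * s"] by simp
    with Suc show ?case
      by (simp add: algebra_simps abs_le_iff)
  qed simp
  have L: "L \<ge> 0"
    using assms[of 0 0] by linarith
  have le: "(a s - L) / real s \<le> (a t + L) / real t" if ge: "s \<ge> 1" "t \<ge> 1" for s t
  proof -
    obtain s' where s: "s = Suc s'"
      using ge(1) by (cases s) auto
    obtain t' where t: "t = Suc t'"
      using ge(2) by (cases t) auto
    note st = s t
    have "\<bar>a (t * s) - real t * a s\<bar> \<le> real t * L" "\<bar>a (t * s) - real s * a t\<bar> \<le> real s * L"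
      using mult[of t' s] mult[of s' t] L unfolding st by (simp_all add: mult.commute algebra_simps)
    then have "real t * (a s - L) \<le> real s * (a t + L)"
      by (simp add: algebra_simps abs_le_iff)
    then show ?thesis
      using that by (simp add: field_simps)
  qed
  define Q where "Q = (\<lambda>s. (a s - L) / real s) ` {1..}"
  define P where "P = Sup Q"
  have upper: "P \<le> (a t + L) / real t" if "t \<ge> 1" for t
    unfolding P_def by (rule cSup_least) (use le that in \<open>auto simp: Q_def\<close>)
  have "bdd_above Q"
    using le[of _ 1] by (auto simp: Q_def intro!: bdd_aboveI)
  then have lower: "(a t - L) / real t \<le> P" if "t \<ge> 1" for t
    unfolding P_def using that by (intro cSup_upper) (auto simp: Q_def)
  have "\<bar>a s - real s * P\<bar> \<le> L" for s
  proof (cases "s = 0")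
    case True
    then show ?thesis using assms[of 0 0] by simp
  next
    case False
    then show ?thesis
      using upper[of s] lower[of s] by (simp add: field_simps abs_le_iff)
  qed
  then show ?thesis by blast
qed

text \<open>Invariance on measurable sets says that \<open>\<rho>\<close> is its own image under the
  shift; a change of variables gives one induction step.\<close>

lemma shift_invariant_integral:
  fixes g :: "(int \<Rightarrow> nat) \<Rightarrow> real"
  assumes \<rho>: "borel_probability d \<rho>" "shift_invariant \<rho>" and g: "local_fun d g"
  shows "(LINT x|\<rho>. g (translate (int k) x)) = (LINT x|\<rho>. g x)"
proof (induction k)
  case 0
  show ?case
    by (rule Bochner_Integration.integral_cong) (simp_all add: borel_probability_space[OF \<rho>(1)] translate_0)
next
  case (Suc k)
  have T: "shift \<in> measurable \<rho> \<rho>"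
    using \<rho>(2) by (intro measurableI)
      (auto simp: shift_invariant_def borel_probability_space[OF \<rho>(1)] shift_eq_translate)
  have distr: "distr \<rho> \<rho> shift = \<rho>"
    using \<rho>(2) by (intro measure_eqI) (auto simp: emeasure_distr[OF T] shift_invariant_def)
  have "(LINT x|\<rho>. g (translate (int (Suc k)) x)) = (LINT x|\<rho>. g (translate (int k) (shift x)))"
    by (simp add: shift_eq_translate translate_translate algebra_simps)
  also have "\<dots> = (LINT x|distr \<rho> \<rho> shift. g (translate (int k) x))"
    by (rule integral_distr[symmetric, OF T]) (rule local_fun_measurable[OF \<rho>(1) local_fun_translate[OF g]])
  finally show ?case
    using Suc distr by simp
qed

context finite_range_system
begin

lemma mean_bounds:
  assumes "local_fun d g" "\<And>x. x \<in> points \<Longrightarrow> a \<le> g x \<and> g x \<le> b"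
  shows "a \<le> mean g" "mean g \<le> b"
proof -
  note lim = window_expec_mean[OF assms(1) ones_in]
  show "a \<le> mean g"
    by (rule tendsto_lowerbound[OF lim]) (use expec_bounds(1)[OF ones_in assms(2)] in auto)
  show "mean g \<le> b"
    by (rule tendsto_upperbound[OF lim]) (use expec_bounds(2)[OF ones_in assms(2)] in auto)
qed

lemma mean_mult_left:
  assumes "local_fun d g"
  shows "mean (\<lambda>x. c * g x) = c * mean g"
proof (rule mean_eqI)
  show "local_fun d (\<lambda>x. c * g x)"
    by (rule local_fun_comp[OF assms])
  show "(\<lambda>n. window_expec n (\<lambda>x. c * g x) ones) \<longlonglongrightarrow> c * mean g"
    unfolding expec_mult_left by (intro tendsto_intros window_expec_mean assms ones_in)
qed

lemma mean_diff:
  assumes "local_fun d g" "local_fun d h"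
  shows "mean (\<lambda>x. g x - h x) = mean g - mean h"
  using mean_add[OF assms(1) local_fun_uminus[OF assms(2)]] mean_mult_left[OF assms(2), of "- 1"]
  by simp

lemma mean_mono:
  assumes "local_fun d g" "local_fun d h" "\<And>x. x \<in> points \<Longrightarrow> g x \<le> h x"
  shows "mean g \<le> mean h"
  using mean_nonneg[OF local_fun_diff[OF assms(2,1)]] assms by (simp add: mean_diff)

lemma mean_sum:
  assumes "\<And>i. i \<in> I \<Longrightarrow> local_fun d (g i)"
  shows "mean (\<lambda>x. \<Sum>i\<in>I. g i x) = (\<Sum>i\<in>I. mean (g i))"
proof (cases "finite I")
  case True
  then show ?thesis
    using assms
  proof (induction I)
    case (insert i I)
    have "mean (\<lambda>x. \<Sum>j\<in>insert i I. g j x) = mean (\<lambda>x. g i x + (\<Sum>j\<in>I. g j x))"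
      using insert.hyps by simp
    also have "\<dots> = mean (g i) + mean (\<lambda>x. \<Sum>j\<in>I. g j x)"
      using insert.prems by (intro mean_add local_fun_sum) auto
    finally show ?case
      using insert by simp
  qed (simp add: mean_const)
qed (simp add: mean_const)

text \<open>The fiber of \<open>ones\<close> lists each word on \<open>J\<close> exactly once.
  Integrals and means thus become the same linear combination of cylinder masses, and comparing
  measures reduces to comparing cylinders.\<close>

lemma local_expansion:
  fixes g :: "(int \<Rightarrow> nat) \<Rightarrow> real"
  assumes "finite J" "depends_on d J g" "x \<in> points"
  shows "g x = (\<Sum>y\<in>fiber d J ones. g y * indicator (cylinder d J y) x)"
proof -
  let ?x = "override_on ones x J"
  have "(\<Sum>y\<in>fiber d J ones. g y * indicator (cylinder d J y) x)
      = (\<Sum>y\<in>fiber d J ones. if y = ?x then g ?x else 0)"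
  proof (rule sum.cong)
    fix y assume y: "y \<in> fiber d J ones"
    have "x \<in> cylinder d J y \<longleftrightarrow> y = ?x"
      using y assms(3) by (auto simp: cylinder_def fiber_def override_on_def)
    then show "g y * indicator (cylinder d J y) x = (if y = ?x then g ?x else 0)"
      by (simp add: indicator_def)
  qed simp
  also have "\<dots> = g ?x"
    using override_on_in_fiber[OF ones_in assms(3)] assms(1) by simp
  also have "\<dots> = g x"
    using assms(3) by (intro depends_onD[OF assms(2)]) auto
  finally show ?thesis by simp
qed

lemma integral_expansion:
  fixes g :: "(int \<Rightarrow> nat) \<Rightarrow> real"
  assumes \<rho>: "borel_probability d \<rho>" and J: "finite J" "0 \<notin> J" and g: "depends_on d J g"
  shows "(LINT x|\<rho>. g x) = (\<Sum>y\<in>fiber d J ones. g y * measure \<rho> (cylinder d J y))"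
proof -
  interpret prob_space \<rho>
    using \<rho> by (rule borel_probability_prob_space)
  have cyl: "cylinder d J y \<in> sets \<rho>" for y
    by (rule local_sets_measurable[OF \<rho> cylinder_local[OF J]])
  have "(LINT x|\<rho>. g x) = (LINT x|\<rho>. (\<Sum>y\<in>fiber d J ones. g y * indicator (cylinder d J y) x))"
    by (intro Bochner_Integration.integral_cong refl local_expansion J g)
      (simp add: borel_probability_space[OF \<rho>])
  also have "\<dots> = (\<Sum>y\<in>fiber d J ones. g y * measure \<rho> (cylinder d J y))"
    using cyl local_fun_integrable[OF d_pos \<rho> local_fun_indicator[OF cylinder_local[OF J]]]
    by (subst Bochner_Integration.integral_sum) auto
  finally show ?thesis .
qed

lemma mean_expansion:
  assumes J: "finite J" "0 \<notin> J" and g: "depends_on d J g"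
  shows "mean g = (\<Sum>y\<in>fiber d J ones. g y * mean (indicator (cylinder d J y)))"
proof -
  have loc: "local_fun d (indicator (cylinder d J y) :: _ \<Rightarrow> real)" for y
    by (rule local_fun_indicator[OF cylinder_local[OF J]])
  have "mean (\<lambda>x. \<Sum>y\<in>fiber d J ones. g y * indicator (cylinder d J y) x) = mean g"
    by (intro mean_cong local_fun_sum local_fun_mult local_fun_const loc
        local_expansion[symmetric] J g)
  then show ?thesis
    by (simp add: mean_sum mean_mult_left loc local_fun_mult local_fun_const)
qed

text \<open>The choice is canonical: a Borel probability is determined by its values on local
  sets.\<close>

definition mean_measure :: "(int \<Rightarrow> nat) measure" where
  "mean_measure = (SOME \<mu>. borel_probability d \<mu> \<and> (\<forall>A\<in>local_sets d. measure \<mu> A = mean (indicator A)))"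

lemma mean_measure_borel: "borel_probability d mean_measure"
  and measure_mean_measure: "A \<in> local_sets d \<Longrightarrow> measure mean_measure A = mean (indicator A)"
  using someI_ex[OF exists_mean_measure] unfolding mean_measure_def by blast+

lemma integral_mean_measure:
  assumes "local_fun d g"
  shows "(LINT x|mean_measure. g x) = mean g"
proof -
  from assms obtain m where m: "depends_on d (window m) g"
    by (auto simp: local_fun_def)
  show ?thesis
    by (simp add: integral_expansion[OF mean_measure_borel _ _ m] mean_expansion[OF _ _ m]
        measure_mean_measure cylinder_local)
qed

lemma eq_mean_measureI:
  assumes "borel_probability d \<rho>" "\<And>g. local_fun d g \<Longrightarrow> (LINT x|\<rho>. g x) = mean g"
  shows "\<rho> = mean_measure"
proof (rule borel_probability_eqI[OF assms(1) mean_measure_borel])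
  fix A assume A: "A \<in> local_sets d"
  interpret prob_space \<rho>
    using assms(1) by (rule borel_probability_prob_space)
  have "A \<in> sets \<rho>"
    by (rule local_sets_measurable[OF assms(1) A])
  then have "measure \<rho> A = (LINT x|\<rho>. indicator A x)"
    by simp
  then show "measure \<rho> A = measure mean_measure A"
    using assms(2)[OF local_fun_indicator[OF A]] measure_mean_measure[OF A] by simp
qed

theorem gibbs_iff_mean_measure:
  assumes "borel_probability d \<alpha>"
  shows "c_star_gibbs d U \<alpha> \<longleftrightarrow> \<alpha> = mean_measure"
  using gibbs_iff_mean[OF assms] eq_mean_measureI[OF assms] integral_mean_measure by blast

text \<open>Translation carries symmetric windows to asymmetric ones, but \<open>mean\<close> is
  preserved by expectations over any interval. Over the translated window the expectation is
  uniformly close to the constant \<open>mean g\<close>.\<close>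

lemma mean_translate:
  assumes g: "local_fun d g"
  shows "mean (\<lambda>x. g (translate k x)) = mean g"
proof -
  have loc: "local_fun d (\<lambda>x. g (translate k x))"
    by (rule local_fun_translate[OF g])
  have "\<bar>mean (\<lambda>x. g (translate k x)) - mean g\<bar> \<le> \<epsilon>" if \<epsilon>: "\<epsilon> > 0" for \<epsilon>
  proof -
    obtain N where N: "\<And>n x. N \<le> n \<Longrightarrow> x \<in> points \<Longrightarrow> \<bar>window_expec n g x - mean g\<bar> \<le> \<epsilon>"
      using window_expec_near_mean[OF g \<epsilon>] by blast
    have "mean (\<lambda>x. g (translate k x)) = mean (expec (- int N + k) (int N + k) (\<lambda>x. g (translate k x)))"
      by (rule mean_expec[OF loc, symmetric])
    also have "\<dots> = mean (\<lambda>x. window_expec N g (translate k x))"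
      by (rule mean_cong[OF expec_local[OF loc]]) (simp add: expec_translate)
    finally have eq: "mean (\<lambda>x. g (translate k x)) = mean (\<lambda>x. window_expec N g (translate k x))" .
    have b: "mean g - \<epsilon> \<le> window_expec N g (translate k x) \<and> window_expec N g (translate k x) \<le> mean g + \<epsilon>"
      if "x \<in> points" for x
      using N[of N "translate k x"] that by (simp add: abs_le_iff)
    show ?thesis
      unfolding eq using mean_bounds[OF local_fun_translate[OF expec_local[OF g]] b] by (simp add: abs_le_iff)
  qed
  then have "\<bar>mean (\<lambda>x. g (translate k x)) - mean g\<bar> \<le> 0"
    by (rule field_le_epsilon) simp
  then show ?thesis by simp
qed

lemma mean_measure_invariant: "shift_invariant mean_measure"
proof -
  let ?\<mu> = mean_measure
  note \<mu> = mean_measure_borel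
  interpret prob_space ?\<mu>
    using \<mu> by (rule borel_probability_prob_space)
  have T: "shift \<in> measurable ?\<mu> ?\<mu>"
  proof (rule measurable_local[OF \<mu> borel_probability_sets[OF \<mu>]])
    show "local_fun d (\<lambda>z. shift z \<in> A)" if "A \<in> local_sets d" for A
      unfolding shift_eq_translate using that by (intro local_fun_translate) (simp add: local_sets_def)
  qed (simp add: shift_eq_translate)
  have D: "borel_probability d (distr ?\<mu> ?\<mu> shift)"
    using \<mu> prob_space_distr[OF T] by (simp add: borel_probability_def)
  have "distr ?\<mu> ?\<mu> shift = ?\<mu>"
  proof (rule eq_mean_measureI[OF D])
    fix g :: "(int \<Rightarrow> nat) \<Rightarrow> real" assume g: "local_fun d g"
    have "(LINT x|distr ?\<mu> ?\<mu> shift. g x) = (LINT x|?\<mu>. g (translate 1 x))"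
      unfolding shift_eq_translate[symmetric] by (rule integral_distr[OF T local_fun_measurable[OF \<mu> g]])
    also have "\<dots> = mean g"
      using integral_mean_measure[OF local_fun_translate[OF g]] mean_translate[OF g] by simp
    finally show "(LINT x|distr ?\<mu> ?\<mu> shift. g x) = mean g" .
  qed
  then have "emeasure ?\<mu> (shift -` A \<inter> space ?\<mu>) = emeasure ?\<mu> A" if "A \<in> sets ?\<mu>" for A
    using emeasure_distr[OF T that] by simp
  then show ?thesis
    using measurable_sets[OF T] by (simp add: shift_invariant_def)
qed

section \<open>Mixing of the limiting mean\<close>

lemma expec_mult_off:
  assumes x: "x \<in> points" and h: "depends_on d J h" "J \<inter> seg p q = {}"
  shows "expec p q (\<lambda>y. g y * h y) x = expec p q g x * h x"
proof -
  have "h y = h x" if y: "y \<in> fiber d (seg p q) x" for y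
  proof (rule depends_onD[OF h(1)])
    fix j assume "j \<in> J"
    with h(2) y show "y j = x j"
      by (auto simp: fiber_def)
  qed (use x fiber_in_space[OF y] in auto)
  then have "expec p q (\<lambda>y. g y * h y) x = expec p q (\<lambda>y. h x * g y) x"
    by (intro expec_cong) simp
  then show ?thesis
    by (simp add: expec_mult_left)
qed

text \<open>The expectation is taken over a window so large that \<open>g\<close> becomes almost
  constant, while the translate of \<open>h\<close> lies outside that window and factors
  out.\<close>

lemma mean_mixing:
  assumes g: "local_fun d g" and h: "local_fun d h" and \<epsilon>: "\<epsilon> > 0"
  obtains K where "\<And>k. K \<le> k \<Longrightarrow> \<bar>mean (\<lambda>x. g x * h (translate (int k) x)) - mean g * mean h\<bar> \<le> \<epsilon>"
proof -
  obtain b where b: "\<And>x. x \<in> points \<Longrightarrow> \<bar>h x\<bar> \<le> b"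
    using local_fun_bounded[OF d_pos h] unfolding real_norm_def by blast
  have b0: "b \<ge> 0"
    using b[OF ones_in] by linarith
  \<comment> \<open>\<open>b + 1\<close> instead of \<open>b\<close> keeps the denominator positive
    when \<open>h\<close> vanishes.\<close>
  then have "\<epsilon> / (b + 1) > 0"
    using \<epsilon> by simp
  then obtain N where N: "\<And>n x. N \<le> n \<Longrightarrow> x \<in> points \<Longrightarrow> \<bar>window_expec n g x - mean g\<bar> \<le> \<epsilon> / (b + 1)"
    using window_expec_near_mean[OF g] by blast
  from h obtain m where m: "depends_on d (seg (- int m) (int m)) h"
    by (auto simp: local_fun_def window_eq_seg)
  show ?thesis
  proof (rule that)
    \<comment> \<open>The translate of \<open>h\<close> starts at position \<open>k - m\<close>,
      hence at or beyond the end \<open>N\<close> of the window.\<close>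
    fix k assume k: "N + m \<le> k"
    let ?h = "\<lambda>x. h (translate (int k) x)"
    have dep: "depends_on d (seg (- int m + int k) (int m + int k)) ?h"
      by (rule depends_on_translate[OF m])
    have disj: "seg (- int m + int k) (int m + int k) \<inter> seg (- int N) (int N) = {}"
      using k by (auto simp: mem_seg)
    have loc: "local_fun d ?h"
      by (rule local_fun_translate[OF h])
    have "mean (\<lambda>x. g x * ?h x) = mean (window_expec N (\<lambda>x. g x * ?h x))"
      by (rule mean_expec[symmetric]) (intro local_fun_mult g loc)
    also have "\<dots> = mean (\<lambda>x. window_expec N g x * ?h x)"
      by (rule mean_cong) (simp_all add: expec_local local_fun_mult g loc expec_mult_off[OF _ dep disj])
    finally have "mean (\<lambda>x. g x * ?h x) - mean g * mean h
        = mean (\<lambda>x. window_expec N g x * ?h x) - mean (\<lambda>x. mean g * ?h x)"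
      by (simp add: mean_mult_left[OF loc] mean_translate[OF h])
    also have "\<dots> = mean (\<lambda>x. window_expec N g x * ?h x - mean g * ?h x)"
      by (rule mean_diff[symmetric]; intro local_fun_mult expec_local local_fun_const g loc)
    finally have eq: "mean (\<lambda>x. g x * ?h x) - mean g * mean h
      = mean (\<lambda>x. window_expec N g x * ?h x - mean g * ?h x)" .
    have "- \<epsilon> \<le> window_expec N g x * ?h x - mean g * ?h x \<and> window_expec N g x * ?h x - mean g * ?h x \<le> \<epsilon>"
      if x: "x \<in> points" for x
    proof -
      have "\<bar>window_expec N g x * ?h x - mean g * ?h x\<bar> = \<bar>window_expec N g x - mean g\<bar> * \<bar>?h x\<bar>"
        by (simp add: left_diff_distrib[symmetric] abs_mult)
      also have "\<dots> \<le> \<epsilon> / (b + 1) * (b + 1)"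
        using N[OF order_refl x] b[OF translate_in[OF x], of "int k"] b0 by (intro mult_mono) auto
      finally show ?thesis
        using b0 by (simp add: abs_le_iff)
    qed
    then have "- \<epsilon> \<le> mean (\<lambda>x. window_expec N g x * ?h x - mean g * ?h x)"
      "mean (\<lambda>x. window_expec N g x * ?h x - mean g * ?h x) \<le> \<epsilon>"
      by (intro mean_bounds local_fun_diff local_fun_mult expec_local local_fun_const g loc; blast)+
    then show "\<bar>mean (\<lambda>x. g x * ?h x) - mean g * mean h\<bar> \<le> \<epsilon>"
      unfolding eq by (simp add: abs_le_iff)
  qed
qed

section \<open>Bowen bounds for the limiting measure\<close>

abbreviation word_cylinder :: "nat \<Rightarrow> (int \<Rightarrow> nat) \<Rightarrow> (int \<Rightarrow> nat) set" where
  "word_cylinder s \<equiv> cylinder d (seg 0 (int s))"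

definition birkhoff :: "nat \<Rightarrow> (int \<Rightarrow> nat) \<Rightarrow> real" where
  "birkhoff s x = (\<Sum>k<s. U (translate (int k) x))"

lemma word_cylinder_local: "word_cylinder s x \<in> local_sets d"
  by (rule cylinder_local) (auto simp: mem_seg)

lemma word_indicator_local: "local_fun d (indicator (word_cylinder s x) :: _ \<Rightarrow> real)"
  by (rule local_fun_indicator[OF word_cylinder_local])

lemma word_indicator_depends:
  "depends_on d (seg 0 (int s)) (indicator (word_cylinder s x) :: _ \<Rightarrow> real)"
  by (rule depends_onI) (auto simp: cylinder_def indicator_def)

text \<open>The energy has \<open>r\<close> additional terms at either end. Their bound
  \<open>2 * r * B\<close> is relaxed so that all errors are multiples of one constant.\<close>

lemma energy_birkhoff:
  assumes "x \<in> points"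
  shows "\<bar>energy 0 (int s) x - birkhoff s x\<bar> \<le> distortion"
proof -
  let ?A = "{0 - int r..<int s + int r}" and ?B = "{0..<int s}" and ?u = "\<lambda>k. U (translate k x)"
  have "birkhoff s x = (\<Sum>k\<in>?B. ?u k)"
    unfolding birkhoff_def
    by (rule sum.reindex_bij_witness[where i = nat and j = int]) auto
  moreover have "energy 0 (int s) x = (\<Sum>k\<in>?A - ?B. ?u k) + (\<Sum>k\<in>?B. ?u k)"
    unfolding energy_def by (rule sum.subset_diff) auto
  ultimately have "\<bar>energy 0 (int s) x - birkhoff s x\<bar> = \<bar>\<Sum>k\<in>?A - ?B. ?u k\<bar>"
    by simp
  also have "\<dots> \<le> (\<Sum>k\<in>?A - ?B. \<bar>?u k\<bar>)"
    by (rule sum_abs)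
  also have "\<dots> \<le> real (card (?A - ?B)) * B"
    using U_bound assms by (intro sum_bounded_above) auto
  also have "card (?A - ?B) = 2 * r"
    by (subst card_Diff_subset) auto
  also have "real (2 * r) * B \<le> distortion"
    using B_nonneg by (simp add: distortion_def mult_right_mono)
  finally show ?thesis .
qed

lemma expec_cylinder:
  assumes "z \<in> points" "x \<in> points"
  shows "expec p q (indicator (cylinder d (seg p q) x)) z
    = exp (energy p q (override_on z x (seg p q))) / weight p q z"
proof -
  let ?y = "override_on z x (seg p q)"
  have "(\<Sum>y\<in>fiber d (seg p q) z. exp (energy p q y) * indicator (cylinder d (seg p q) x) y)
      = (\<Sum>y\<in>fiber d (seg p q) z. if y = ?y then exp (energy p q ?y) else 0)"
  proof (rule sum.cong)
    fix y assume y: "y \<in> fiber d (seg p q) z"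
    then have "y \<in> cylinder d (seg p q) x \<longleftrightarrow> y = ?y"
      by (auto simp: cylinder_def fiber_def override_on_def)
    then show "exp (energy p q y) * indicator (cylinder d (seg p q) x) y
        = (if y = ?y then exp (energy p q ?y) else 0)"
      by (simp add: indicator_def)
  qed simp
  then show ?thesis
    using override_on_in_fiber[OF assms] by (simp add: expec_def)
qed

text \<open>The normalizing weight cancels in the ratio of the conditional probabilities, so no estimate of
  partition functions is needed.\<close>

lemma word_cylinder_compare:
  assumes xy: "x \<in> points" "y \<in> points"
  shows "mean (indicator (word_cylinder s x))
    \<le> exp (4 * distortion + birkhoff s x - birkhoff s y) * mean (indicator (word_cylinder s y))"
proof -
  let ?c = "exp (4 * distortion + birkhoff s x - birkhoff s y)"
  let ?E = "\<lambda>x. expec 0 (int s) (indicator (word_cylinder s x))"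
  have near: "\<bar>energy 0 (int s) (override_on z x (seg 0 (int s))) - birkhoff s x\<bar> \<le> 2 * distortion"
    if "z \<in> points" "x \<in> points" for z x
  proof -
    have "\<bar>energy 0 (int s) (override_on z x (seg 0 (int s))) - energy 0 (int s) x\<bar> \<le> distortion"
      using that by (intro energy_distortion) auto
    with energy_birkhoff[OF that(2), of s] show ?thesis
      by linarith
  qed
  have "?E x z \<le> ?c * ?E y z" if z: "z \<in> points" for z
  proof -
    have "exp (energy 0 (int s) (override_on z x (seg 0 (int s))))
        \<le> ?c * exp (energy 0 (int s) (override_on z y (seg 0 (int s))))"
      using near[OF z xy(1)] near[OF z xy(2)] by (simp flip: exp_add)
    then show ?thesis
      using weight_pos[OF z, of 0 "int s"] by (simp add: expec_cylinder z xy divide_right_mono)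
  qed
  then have "mean (?E x) \<le> mean (\<lambda>z. ?c * ?E y z)"
    by (intro mean_mono local_fun_mult local_fun_const expec_local word_indicator_local)
  also have "\<dots> = ?c * mean (?E y)"
    by (intro mean_mult_left expec_local word_indicator_local)
  finally show ?thesis
    by (simp add: mean_expec word_indicator_local)
qed

text \<open>Doeblin's bound is averaged over one of the two boundary conditions; the average of the
  conditional expectation is \<open>mean h\<close>.\<close>

lemma expec_mean_compare:
  assumes h: "depends_on d (seg p q) h" "\<And>u. u \<in> points \<Longrightarrow> h u \<ge> 0" and z: "z \<in> points"
  shows "rate * mean h \<le> expec p q h z" "rate * expec p q h z \<le> mean h"
proof -
  have loc: "local_fun d h"
    by (rule depends_on_seg_local[OF h(1)])
  have "mean (\<lambda>u. rate * expec p q h u) \<le> mean (\<lambda>_. expec p q h z)"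
    using expec_compare[OF _ z h]
    by (intro mean_mono local_fun_mult local_fun_const expec_local loc) auto
  then show "rate * mean h \<le> expec p q h z"
    by (simp add: mean_mult_left expec_local loc mean_expec mean_const)
  have "mean (\<lambda>_. rate * expec p q h z) \<le> mean (expec p q h)"
    using expec_compare[OF z _ h] by (intro mean_mono local_fun_const expec_local loc) auto
  then show "rate * expec p q h z \<le> mean h"
    by (simp add: loc mean_expec mean_const)
qed

text \<open>Positivity in finite volume could be lost in a limit; the factor \<open>rate\<close>,
  uniform in the boundary condition, preserves it.\<close>

lemma mean_word_cylinder_pos:
  assumes "x \<in> points"
  shows "mean (indicator (word_cylinder s x)) > 0"
proof -
  have "0 < rate * expec 0 (int s) (indicator (word_cylinder s x)) ones"
    using rate_pos weight_pos[OF ones_in, of 0 "int s"] assms by (simp add: expec_cylinder)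
  also have "\<dots> \<le> mean (indicator (word_cylinder s x))"
    by (rule expec_mean_compare(2)[OF word_indicator_depends]) auto
  finally show ?thesis .
qed

text \<open>Since \<open>ones\<close> is fixed by the shift, its cylinder of length
  \<open>s + t\<close> is the cylinder of length \<open>s\<close> intersected with a translate of
  the one of length \<open>t\<close>. A general word would not stay in one family.\<close>

definition ones_mass :: "nat \<Rightarrow> real" where
  "ones_mass s = mean (indicator (word_cylinder s ones))"

lemma ones_mass_pos: "ones_mass s > 0"
  by (simp add: ones_mass_def mean_word_cylinder_pos)

lemma mem_ones_cylinder:
  "x \<in> word_cylinder s ones \<longleftrightarrow> x \<in> points \<and> (\<forall>i. 0 \<le> i \<and> i < int s \<longrightarrow> x (ix i) = 1)"
  by (auto simp: cylinder_def seg_def ones_def)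

text \<open>Averaging over the first block leaves the second factor untouched, and the conditional
  probability of the first block is its mean up to \<open>rate\<close>, whatever the boundary
  condition.\<close>

lemma ones_mass_add:
  "rate * (ones_mass s * ones_mass t) \<le> ones_mass (s + t)"
  "rate * ones_mass (s + t) \<le> ones_mass s * ones_mass t"
proof -
  let ?g = "indicator (word_cylinder s ones) :: _ \<Rightarrow> real"
  let ?h = "\<lambda>x. indicator (word_cylinder t ones) (translate (int s) x) :: real"
  let ?E = "expec 0 (int s) ?g"
  note locs = word_indicator_local expec_local local_fun_translate[OF word_indicator_local]
    local_fun_const local_fun_mult
  have split: "indicator (word_cylinder (s + t) ones) x = ?g x * ?h x" if x: "x \<in> points" for x
  proof -
    have "x \<in> word_cylinder (s + t) ones
        \<longleftrightarrow> x \<in> word_cylinder s ones \<and> translate (int s) x \<in> word_cylinder t ones"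
    proof safe
      assume *: "x \<in> word_cylinder (s + t) ones"
      show "x \<in> word_cylinder s ones" "translate (int s) x \<in> word_cylinder t ones"
        using *[unfolded mem_ones_cylinder] by (auto simp: mem_ones_cylinder)
    next
      assume *: "x \<in> word_cylinder s ones" "translate (int s) x \<in> word_cylinder t ones"
      have "x (ix i) = 1" if "0 \<le> i" "i < int (s + t)" for i
      proof (cases "i < int s")
        case False
        then have "translate (int s) x (ix (i - int s)) = 1"
          using *(2) that unfolding mem_ones_cylinder by (auto simp del: translate_ix)
        then show ?thesis by simp
      qed (use * that in \<open>auto simp: mem_ones_cylinder\<close>)
      then show "x \<in> word_cylinder (s + t) ones"
        using x unfolding mem_ones_cylinder by blast
    qed
    then show ?thesis by (simp add: indicator_def)
  qed
  have dep: "depends_on d (seg (0 + int s) (int t + int s)) ?h"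
    by (rule depends_on_translate[OF word_indicator_depends])
  have disj: "seg (0 + int s) (int t + int s) \<inter> seg 0 (int s) = {}"
    by (auto simp: mem_seg)
  have "ones_mass (s + t) = mean (\<lambda>x. ?g x * ?h x)"
    unfolding ones_mass_def by (rule mean_cong[OF word_indicator_local split])
  also have "\<dots> = mean (expec 0 (int s) (\<lambda>x. ?g x * ?h x))"
    by (rule mean_expec[symmetric]) (intro locs)
  also have "\<dots> = mean (\<lambda>x. ?E x * ?h x)"
    by (rule mean_cong) (simp_all add: locs expec_mult_off[OF _ dep disj])
  finally have eq: "ones_mass (s + t) = mean (\<lambda>x. ?E x * ?h x)" .
  have h: "mean ?h = ones_mass t"
    unfolding ones_mass_def by (rule mean_translate[OF word_indicator_local])
  have cmp: "rate * ones_mass s \<le> ?E x" "rate * ?E x \<le> ones_mass s" if "x \<in> points" for x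
    unfolding ones_mass_def using expec_mean_compare[OF word_indicator_depends _ that] by auto
  have "mean (\<lambda>x. (rate * ones_mass s) * ?h x) \<le> mean (\<lambda>x. ?E x * ?h x)"
    by (intro mean_mono locs mult_right_mono cmp) auto
  then show "rate * (ones_mass s * ones_mass t) \<le> ones_mass (s + t)"
    by (simp add: mean_mult_left locs h eq mult.assoc)
  have "mean (\<lambda>x. rate * (?E x * ?h x)) \<le> mean (\<lambda>x. ones_mass s * ?h x)"
    unfolding mult.assoc[symmetric] by (intro mean_mono locs mult_right_mono cmp) auto
  then show "rate * ones_mass (s + t) \<le> ones_mass s * ones_mass t"
    by (simp add: mean_mult_left locs h eq)
qed

text \<open>The growth rate of the mass of a single word determines the pressure.\<close>

lemma ones_mass_growth: "\<exists>Q. \<forall>s. \<bar>ln (ones_mass s) - real s * Q\<bar> \<le> 2 * distortion"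
proof (rule almost_additive)
  fix s t
  note pos = ones_mass_pos[of s] ones_mass_pos[of t] ones_mass_pos[of "s + t"]
  have "ln (rate * (ones_mass s * ones_mass t)) \<le> ln (ones_mass (s + t))"
    using ones_mass_add(1) pos rate_pos by (intro ln_mono) auto
  moreover have "ln (rate * ones_mass (s + t)) \<le> ln (ones_mass s * ones_mass t)"
    using ones_mass_add(2) pos rate_pos by (intro ln_mono) auto
  ultimately show "\<bar>ln (ones_mass (s + t)) - ln (ones_mass s) - ln (ones_mass t)\<bar> \<le> 2 * distortion"
    using pos rate_pos by (simp add: ln_mult ln_mult_pos rate_def)
qed

lemma translate_ones: "translate k ones = ones"
  by (rule seq_space_eqI[OF translate_in[OF ones_in] ones_in]) (simp add: ones_def)

lemma birkhoff_ones: "birkhoff s ones = real s * U ones"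
  by (simp add: birkhoff_def translate_ones)

text \<open>A point of a cylinder determines the word and thereby the cylinder, so the
  quantification over words collapses to one over points.\<close>

lemma bowen_bounds_iff:
  "bowen_bounds d U \<rho> \<longleftrightarrow> (\<exists>C1>0. \<exists>C2>0. \<exists>P. \<forall>s. \<forall>x\<in>points.
     C1 \<le> measure \<rho> (word_cylinder s x) / exp (- P * real s + birkhoff s x) \<and>
     measure \<rho> (word_cylinder s x) / exp (- P * real s + birkhoff s x) \<le> C2)"
proof -
  have sum: "(\<Sum>k<s. U ((shift ^^ k) x)) = birkhoff s x" if "x \<in> points" for s x
    using that by (simp add: birkhoff_def shift_funpow)
  have cyl: "cylinder d {1..int s} y = word_cylinder s x" if "x \<in> cylinder d {1..int s} y" for s x y
    using that by (auto simp: cylinder_def Icc_eq_seg)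
  have all: "(\<forall>y\<in>{1..int s} \<rightarrow>\<^sub>E {1..d}. \<forall>x\<in>cylinder d {1..int s} y. R (cylinder d {1..int s} y) x)
      \<longleftrightarrow> (\<forall>x\<in>points. R (word_cylinder s x) x)" for s R
  proof safe
    fix x assume *: "\<forall>y\<in>{1..int s} \<rightarrow>\<^sub>E {1..d}. \<forall>x\<in>cylinder d {1..int s} y. R (cylinder d {1..int s} y) x"
      and x: "x \<in> points"
    let ?y = "restrict x {1..int s}"
    have "?y \<in> {1..int s} \<rightarrow>\<^sub>E {1..d}"
      unfolding restrict_PiE_iff using seq_space_range[OF x] by auto
    moreover have mem: "x \<in> cylinder d {1..int s} ?y"
      using x by (simp add: cylinder_def)
    ultimately have "R (cylinder d {1..int s} ?y) x"
      using * by blast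
    then show "R (word_cylinder s x) x"
      using cyl[OF mem] by simp
  next
    fix y x assume *: "\<forall>x\<in>points. R (word_cylinder s x) x" and x: "x \<in> cylinder d {1..int s} y"
    then have "R (word_cylinder s x) x"
      by (simp add: cylinder_def)
    then show "R (cylinder d {1..int s} y) x"
      using cyl[OF x] by simp
  qed
  have "(\<forall>y\<in>{1..int s} \<rightarrow>\<^sub>E {1..d}. \<forall>x\<in>cylinder d {1..int s} y.
        C1 \<le> measure \<rho> (cylinder d {1..int s} y) / exp (- P * real s + (\<Sum>k<s. U ((shift ^^ k) x))) \<and>
        measure \<rho> (cylinder d {1..int s} y) / exp (- P * real s + (\<Sum>k<s. U ((shift ^^ k) x))) \<le> C2)
      \<longleftrightarrow> (\<forall>x\<in>points.
        C1 \<le> measure \<rho> (word_cylinder s x) / exp (- P * real s + birkhoff s x) \<and>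
        measure \<rho> (word_cylinder s x) / exp (- P * real s + birkhoff s x) \<le> C2)" for s C1 C2 P
    using all[of s "\<lambda>A x. C1 \<le> measure \<rho> A / exp (- P * real s + (\<Sum>k<s. U ((shift ^^ k) x))) \<and>
        measure \<rho> A / exp (- P * real s + (\<Sum>k<s. U ((shift ^^ k) x))) \<le> C2"]
    by (simp only: sum cong: ball_cong)
  then show ?thesis
    by (simp only: bowen_bounds_def)
qed

lemma mean_measure_bowen: "bowen_bounds d U mean_measure"
proof -
  obtain Q where Q: "\<And>s. \<bar>ln (ones_mass s) - real s * Q\<bar> \<le> 2 * distortion"
    using ones_mass_growth by blast
  \<comment> \<open>\<open>4\<close> comes from the comparison with the word of \<open>ones\<close>
    and \<open>2\<close> from the growth estimate. As
    \<open>birkhoff s ones = real s * U ones\<close>, this \<open>?P\<close> gives the cylinder of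
    \<open>ones\<close> the order \<open>exp (real s * Q)\<close>.\<close>
  let ?D = "6 * distortion" and ?P = "U ones - Q"
  have "exp (- ?D) \<le> mean (indicator (word_cylinder s x)) / exp (- ?P * real s + birkhoff s x)
      \<and> mean (indicator (word_cylinder s x)) / exp (- ?P * real s + birkhoff s x) \<le> exp ?D"
    if x: "x \<in> points" for s x
  proof -
    let ?m = "mean (indicator (word_cylinder s x))"
    have m: "?m > 0"
      by (rule mean_word_cylinder_pos[OF x])
    have "ln ?m \<le> ln (exp (4 * distortion + birkhoff s x - birkhoff s ones) * ones_mass s)"
      unfolding ones_mass_def by (intro ln_mono m word_cylinder_compare x ones_in mult_pos_pos
          mean_word_cylinder_pos exp_gt_zero)
    then have upper: "ln ?m \<le> 4 * distortion + birkhoff s x - real s * U ones + ln (ones_mass s)"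
      using ones_mass_pos[of s] by (simp add: ln_mult birkhoff_ones)
    have "ln (ones_mass s) \<le> ln (exp (4 * distortion + birkhoff s ones - birkhoff s x) * ?m)"
      using m ones_mass_pos[of s] unfolding ones_mass_def
      by (intro ln_mono word_cylinder_compare x ones_in mult_pos_pos exp_gt_zero)
    then have lower: "ln (ones_mass s) \<le> 4 * distortion + real s * U ones - birkhoff s x + ln ?m"
      using m by (simp add: ln_mult birkhoff_ones)
    define e where "e = ln ?m - (- ?P * real s + birkhoff s x)"
    have "?m / exp (- ?P * real s + birkhoff s x) = exp e"
      using m by (simp add: e_def exp_diff)
    moreover have "- ?D \<le> e" "e \<le> ?D"
      using Q[of s] upper lower by (simp_all add: e_def abs_le_iff algebra_simps)
    ultimately show ?thesis by simp
  qed
  then show ?thesis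
    unfolding bowen_bounds_iff measure_mean_measure[OF word_cylinder_local]
    by (meson exp_gt_zero)
qed

lemma mean_measure_candidate: "equilibrium_candidate d U mean_measure"
  by (simp add: equilibrium_candidate_def mean_measure_borel mean_measure_invariant mean_measure_bowen)

section \<open>Comparison of candidates on cylinders and uniqueness\<close>

definition partition_sum :: "nat \<Rightarrow> real" where
  "partition_sum s = (\<Sum>y\<in>fiber d (seg 0 (int s)) ones. exp (birkhoff s y))"

lemma partition_sum_pos: "partition_sum s > 0"
  unfolding partition_sum_def using fiber_self[OF ones_in] by (intro sum_pos) auto

text \<open>Summing Bowen's inequalities over all words of length \<open>s\<close> gives total mass
  1, so the normalizing factor is the inverse of \<open>partition_sum s\<close> up to
  \<open>C1\<close> and \<open>C2\<close>. The right-hand quantity involves no \<open>P\<close>, so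
  candidates can be compared without comparing their pressures.\<close>

lemma candidate_cylinder:
  assumes "equilibrium_candidate d U \<rho>"
  shows "\<exists>C>0. \<forall>s. \<forall>x\<in>points. measure \<rho> (word_cylinder s x) \<le> C * (exp (birkhoff s x) / partition_sum s)
    \<and> exp (birkhoff s x) / partition_sum s \<le> C * measure \<rho> (word_cylinder s x)"
proof -
  have \<rho>: "borel_probability d \<rho>"
    using assms by (simp add: equilibrium_candidate_def)
  interpret prob_space \<rho>
    using \<rho> by (rule borel_probability_prob_space)
  obtain C1 C2 P where C: "C1 > 0" "C2 > 0" and ratio: "\<And>s x. x \<in> points \<Longrightarrow>
     C1 \<le> measure \<rho> (word_cylinder s x) / exp (- P * real s + birkhoff s x) \<and>
     measure \<rho> (word_cylinder s x) / exp (- P * real s + birkhoff s x) \<le> C2"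
    using assms unfolding equilibrium_candidate_def bowen_bounds_iff by blast
  define k where "k s = exp (- P * real s)" for s :: nat
  have bnd: "C1 * k s * exp (birkhoff s x) \<le> measure \<rho> (word_cylinder s x)"
    "measure \<rho> (word_cylinder s x) \<le> C2 * k s * exp (birkhoff s x)" if "x \<in> points" for s x
  proof -
    have "exp (- P * real s + birkhoff s x) = k s * exp (birkhoff s x)"
      by (simp only: k_def exp_add)
    moreover have "k s > 0"
      by (simp add: k_def)
    ultimately show "C1 * k s * exp (birkhoff s x) \<le> measure \<rho> (word_cylinder s x)"
      "measure \<rho> (word_cylinder s x) \<le> C2 * k s * exp (birkhoff s x)"
      using ratio[OF that, of s] by (simp_all add: pos_le_divide_eq pos_divide_le_eq mult.assoc)
  qed
  \<comment> \<open>The expansion of the constant function 1: the cylinders over the fiber of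
    \<open>ones\<close> partition the space.\<close>
  have total: "(\<Sum>y\<in>fiber d (seg 0 (int s)) ones. measure \<rho> (word_cylinder s y)) = 1" for s
    using integral_expansion[OF \<rho> finite_seg _ depends_on_const, of 0 "int s" 1] prob_space
    by (simp add: mem_seg)
  have low: "C1 * k s * partition_sum s \<le> 1" for s
    unfolding total[of s, symmetric] partition_sum_def sum_distrib_left
    using bnd fiber_in_space by (intro sum_mono) blast
  have up: "1 \<le> C2 * k s * partition_sum s" for s
    unfolding total[of s, symmetric] partition_sum_def sum_distrib_left
    using bnd fiber_in_space by (intro sum_mono) blast
  have "measure \<rho> (word_cylinder s x) \<le> C2 / C1 * (exp (birkhoff s x) / partition_sum s)"
    "exp (birkhoff s x) / partition_sum s \<le> C2 / C1 * measure \<rho> (word_cylinder s x)"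
    if x: "x \<in> points" for s x
  proof -
    have "k s \<le> 1 / (C1 * partition_sum s)"
      using low[of s] C partition_sum_pos[of s] by (simp add: field_simps)
    then have "C2 * k s * exp (birkhoff s x) \<le> C2 * (1 / (C1 * partition_sum s)) * exp (birkhoff s x)"
      using C by (intro mult_right_mono mult_left_mono) auto
    with bnd(2)[OF x, of s] show "measure \<rho> (word_cylinder s x) \<le> C2 / C1 * (exp (birkhoff s x) / partition_sum s)"
      by simp
    have "1 / partition_sum s \<le> C2 * k s"
      using up[of s] partition_sum_pos[of s] by (simp add: field_simps)
    then have "exp (birkhoff s x) * (1 / partition_sum s) \<le> exp (birkhoff s x) * (C2 * k s)"
      by (intro mult_left_mono) auto
    also have "\<dots> = C2 / C1 * (C1 * k s * exp (birkhoff s x))"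
      using C by simp
    also have "\<dots> \<le> C2 / C1 * measure \<rho> (word_cylinder s x)"
      using bnd(1)[OF x, of s] C by (intro mult_left_mono) auto
    finally show "exp (birkhoff s x) / partition_sum s \<le> C2 / C1 * measure \<rho> (word_cylinder s x)"
      by simp
  qed
  moreover have "C2 / C1 > 0"
    using C by simp
  ultimately show ?thesis by blast
qed

text \<open>The upper estimate for \<open>\<rho>\<close> is combined with the lower one for
  \<open>mean_measure\<close>; both refer to the same quotient by the partition sum.\<close>

lemma candidate_dominated:
  assumes "equilibrium_candidate d U \<rho>"
  obtains C where "C > 0"
    "\<And>g. local_fun d g \<Longrightarrow> (\<And>x. x \<in> points \<Longrightarrow> g x \<ge> 0) \<Longrightarrow> (LINT x|\<rho>. g x) \<le> C * mean g"
proof -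
  have \<rho>: "borel_probability d \<rho>" "shift_invariant \<rho>"
    using assms by (simp_all add: equilibrium_candidate_def)
  obtain C where C: "C > 0" "\<And>s x. x \<in> points \<Longrightarrow>
      measure \<rho> (word_cylinder s x) \<le> C * (exp (birkhoff s x) / partition_sum s)"
    using candidate_cylinder[OF assms] by blast
  obtain C' where C': "C' > 0" "\<And>s x. x \<in> points \<Longrightarrow>
      exp (birkhoff s x) / partition_sum s \<le> C' * mean (indicator (word_cylinder s x))"
    using candidate_cylinder[OF mean_measure_candidate]
    unfolding measure_mean_measure[OF word_cylinder_local] by blast
  have dom: "measure \<rho> (word_cylinder s x) \<le> C * C' * mean (indicator (word_cylinder s x))"
    if x: "x \<in> points" for s x
    using order_trans[OF C(2)[OF x] mult_left_mono[OF C'(2)[OF x]]] C(1) by (simp add: mult.assoc)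
  show ?thesis
  proof (rule that)
    show "C * C' > 0"
      using C(1) C'(1) by simp
    fix g :: "(int \<Rightarrow> nat) \<Rightarrow> real"
    assume g: "local_fun d g" and nonneg: "\<And>x. x \<in> points \<Longrightarrow> g x \<ge> 0"
    from g obtain m where m: "depends_on d (seg (- int m) (int m)) g"
      by (auto simp: local_fun_def window_eq_seg)
    \<comment> \<open>Translation by \<open>m\<close> moves the window to the positions from 0 to
      \<open>2 * m - 1\<close>, where one-sided cylinders apply; invariance of \<open>\<rho>\<close>
      and of \<open>mean\<close> keeps both sides.\<close>
    let ?G = "\<lambda>x. g (translate (int m) x)" and ?J = "seg 0 (int (2 * m))"
    have dep: "depends_on d ?J ?G"
      using depends_on_translate[OF m, of "int m"] by simp
    have J: "finite ?J" "0 \<notin> ?J"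
      by (simp_all add: mem_seg)
    have "(LINT x|\<rho>. g x) = (LINT x|\<rho>. ?G x)"
      by (rule shift_invariant_integral[OF \<rho> g, symmetric])
    also have "\<dots> = (\<Sum>y\<in>fiber d ?J ones. ?G y * measure \<rho> (word_cylinder (2 * m) y))"
      by (rule integral_expansion[OF \<rho>(1) J dep])
    also have "\<dots> \<le> (\<Sum>y\<in>fiber d ?J ones. ?G y * (C * C' * mean (indicator (word_cylinder (2 * m) y))))"
      using nonneg fiber_in_space by (intro sum_mono mult_left_mono dom) auto
    also have "\<dots> = C * C' * (\<Sum>y\<in>fiber d ?J ones. ?G y * mean (indicator (word_cylinder (2 * m) y)))"
      by (simp only: sum_distrib_left mult_ac)
    also have "\<dots> = C * C' * mean ?G"
      by (simp only: mean_expansion[OF J dep])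
    also have "mean ?G = mean g"
      by (rule mean_translate[OF g])
    finally show "(LINT x|\<rho>. g x) \<le> C * C' * mean g" .
  qed
qed

text \<open>Along a sparse sequence of times the translates of a centered local function are almost
  orthogonal with respect to \<open>mean\<close>.\<close>

lemma mean_square_sum:
  assumes f: "local_fun d f" "mean f = 0" and \<epsilon>: "\<epsilon> > 0"
  obtains L :: nat where "\<And>K::nat. mean (\<lambda>x. (\<Sum>i<K. f (translate (int (i * L)) x))\<^sup>2)
    \<le> real K * mean (\<lambda>x. f x * f x) + real K * real K * \<epsilon>"
proof -
  obtain M where M: "\<And>k. M \<le> k \<Longrightarrow> \<bar>mean (\<lambda>x. f x * f (translate (int k) x)) - mean f * mean f\<bar> \<le> \<epsilon>"
    using mean_mixing[OF f(1) f(1) \<epsilon>] by blast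
  define L where "L = Suc M"
  let ?t = "\<lambda>i x. f (translate (int (i * L)) x)"
  have loc: "local_fun d (?t i)" for i
    by (rule local_fun_translate[OF f(1)])
  have shifted: "mean (\<lambda>x. ?t i x * ?t j x) = mean (\<lambda>x. f x * f (translate (int ((j - i) * L)) x))"
    if "i \<le> j" for i j
  proof -
    have "int ((j - i) * L) + int (i * L) = int (j * L)"
      using that by (simp add: of_nat_diff algebra_simps)
    then have "(\<lambda>x. ?t i x * ?t j x)
        = (\<lambda>x. (\<lambda>x. f x * f (translate (int ((j - i) * L)) x)) (translate (int (i * L)) x))"
      by (simp add: translate_translate)
    then show ?thesis
      using mean_translate[OF local_fun_mult[OF f(1) local_fun_translate[OF f(1)]],
          of "int (i * L)" "int ((j - i) * L)"] by simp
  qed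
  have off: "mean (\<lambda>x. ?t i x * ?t j x) \<le> \<epsilon>" if "i < j" for i j
  proof -
    have "1 * L \<le> (j - i) * L"
      using that by (intro mult_right_mono) auto
    then have "M \<le> (j - i) * L"
      by (simp add: L_def)
    from M[OF this] show ?thesis
      using shifted[of i j] that f(2) by simp
  qed
  have cov: "mean (\<lambda>x. ?t i x * ?t j x) \<le> (if j = i then mean (\<lambda>x. f x * f x) else 0) + \<epsilon>" for i j
  proof (cases i j rule: linorder_cases)
    case equal
    have "mean (\<lambda>x. f x * f (translate 0 x)) = mean (\<lambda>x. f x * f x)"
      by (rule mean_cong[OF local_fun_mult[OF f(1) local_fun_translate[OF f(1)]]]) (simp add: translate_0)
    with equal show ?thesis
      using shifted[of i i] \<epsilon> by simp
  qed (use off[of i j] off[of j i] in \<open>auto simp: mult.commute\<close>)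
  show ?thesis
  proof (rule that)
    fix K :: nat
    have "mean (\<lambda>x. (\<Sum>i<K. ?t i x)\<^sup>2) = mean (\<lambda>x. \<Sum>i<K. \<Sum>j<K. ?t i x * ?t j x)"
      by (simp add: power2_eq_square sum_product)
    also have "\<dots> = (\<Sum>i<K. \<Sum>j<K. mean (\<lambda>x. ?t i x * ?t j x))"
    proof -
      have "mean (\<lambda>x. \<Sum>i<K. \<Sum>j<K. ?t i x * ?t j x) = (\<Sum>i<K. mean (\<lambda>x. \<Sum>j<K. ?t i x * ?t j x))"
        by (intro mean_sum local_fun_sum local_fun_mult loc)
      also have "\<dots> = (\<Sum>i<K. \<Sum>j<K. mean (\<lambda>x. ?t i x * ?t j x))"
        by (intro sum.cong refl mean_sum local_fun_mult loc)
      finally show ?thesis .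
    qed
    also have "\<dots> \<le> (\<Sum>i<K. \<Sum>j<K. (if j = i then mean (\<lambda>x. f x * f x) else 0) + \<epsilon>)"
      by (intro sum_mono cov)
    also have "\<dots> = real K * mean (\<lambda>x. f x * f x) + real K * real K * \<epsilon>"
      by (simp add: sum.distrib algebra_simps)
    finally show "mean (\<lambda>x. (\<Sum>i<K. ?t i x)\<^sup>2) \<le> real K * mean (\<lambda>x. f x * f x) + real K * real K * \<epsilon>" .
  qed
qed

text \<open>Under \<open>\<rho>\<close> all translates have the same integral \<open>?I\<close>, so
  a sum of \<open>n\<close> of them has integral \<open>n * ?I\<close>. Its square is at most the
  integral of the squared sum, which domination bounds by a mean of order \<open>n\<close> plus a
  small multiple of the square of \<open>n\<close>.\<close>

lemma candidate_integral:
  assumes cand: "equilibrium_candidate d U \<rho>" and g: "local_fun d g"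
  shows "(LINT x|\<rho>. g x) = mean g"
proof -
  have \<rho>: "borel_probability d \<rho>" "shift_invariant \<rho>"
    using cand by (simp_all add: equilibrium_candidate_def)
  interpret prob_space \<rho>
    using \<rho>(1) by (rule borel_probability_prob_space)
  note int = local_fun_integrable[OF d_pos \<rho>(1)]
  obtain C where C: "C > 0"
    "\<And>g. local_fun d g \<Longrightarrow> (\<And>x. x \<in> points \<Longrightarrow> g x \<ge> 0) \<Longrightarrow> (LINT x|\<rho>. g x) \<le> C * mean g"
    using candidate_dominated[OF cand] by blast
  define f where "f x = g x - mean g" for x
  have f: "local_fun d f" "mean f = 0"
    unfolding f_def using g by (auto simp: mean_diff mean_const local_fun_const intro: local_fun_diff)
  let ?I = "LINT x|\<rho>. f x" and ?v = "mean (\<lambda>x. f x * f x)"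
  have key: "?I\<^sup>2 \<le> C * (?v / real (Suc K) + \<epsilon>)" if \<epsilon>: "\<epsilon> > 0" for K \<epsilon>
  proof -
    obtain L where L: "\<And>K::nat. mean (\<lambda>x. (\<Sum>i<K. f (translate (int (i * L)) x))\<^sup>2)
        \<le> real K * ?v + real K * real K * \<epsilon>"
      using mean_square_sum[OF f \<epsilon>] by blast
    let ?n = "real (Suc K)" and ?A = "\<lambda>x. \<Sum>i<Suc K. f (translate (int (i * L)) x)"
    have locA: "local_fun d ?A"
      by (intro local_fun_sum local_fun_translate f)
    have locA2: "local_fun d (\<lambda>x. (?A x)\<^sup>2)"
      by (rule local_fun_comp[OF locA])
    have "integral\<^sup>L \<rho> ?A = (\<Sum>i<Suc K. LINT x|\<rho>. f (translate (int (i * L)) x))"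
      by (intro Bochner_Integration.integral_sum int local_fun_translate f)
    also have "\<dots> = (\<Sum>i<Suc K. ?I)"
      by (intro sum.cong refl shift_invariant_integral[OF \<rho> f(1)])
    also have "\<dots> = ?n * ?I"
      by (simp only: sum_constant card_lessThan)
    finally have "(?n * ?I)\<^sup>2 = (integral\<^sup>L \<rho> ?A)\<^sup>2"
      by (simp only:)
    also have "\<dots> \<le> (LINT x|\<rho>. (?A x)\<^sup>2)"
      \<comment> \<open>Nonnegativity of the variance is the Cauchy-Schwarz inequality on a
        probability space.\<close>
      using variance_eq[OF int[OF locA] int[OF locA2]] variance_positive[of ?A] by linarith
    also have "\<dots> \<le> C * mean (\<lambda>x. (?A x)\<^sup>2)"
      by (rule C(2)[OF locA2 zero_le_power2])
    also have "\<dots> \<le> C * (?n * ?v + ?n * ?n * \<epsilon>)"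
      using L[of "Suc K"] C(1) by (intro mult_left_mono) (simp_all only: less_imp_le)
    also have "\<dots> = ?n\<^sup>2 * (C * (?v / ?n + \<epsilon>))"
      by (simp add: power2_eq_square field_simps)
    finally have "?n\<^sup>2 * ?I\<^sup>2 \<le> ?n\<^sup>2 * (C * (?v / ?n + \<epsilon>))"
      by (simp only: power_mult_distrib)
    then show ?thesis
      by (rule mult_left_le_imp_le) simp
  qed
  \<comment> \<open>The spacing \<open>L\<close> depends on \<open>\<epsilon>\<close> but has left
    the estimate, so \<open>K\<close> may tend to infinity while \<open>\<epsilon>\<close> stays
    fixed.\<close>
  have "?I\<^sup>2 \<le> C * \<epsilon>" if \<epsilon>: "\<epsilon> > 0" for \<epsilon>
  proof (rule tendsto_lowerbound)
    have "(\<lambda>K. ?v / real (Suc K)) \<longlonglongrightarrow> 0"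
      using tendsto_mult[OF tendsto_const[of ?v] LIMSEQ_inverse_real_of_nat]
      by (simp add: divide_inverse)
    then show "(\<lambda>K. C * (?v / real (Suc K) + \<epsilon>)) \<longlonglongrightarrow> C * \<epsilon>"
      using tendsto_mult[OF tendsto_const[of C] tendsto_add[OF _ tendsto_const[of \<epsilon>]]] by fastforce
  qed (use key[OF \<epsilon>] in auto)
  then have "?I\<^sup>2 \<le> 0 + e" if "e > 0" for e
    using that C(1) by (metis add_0 divide_pos_pos nonzero_mult_div_cancel_left less_irrefl times_divide_eq_right)
  then have "?I\<^sup>2 \<le> 0"
    by (rule field_le_epsilon)
  then have "?I = 0" by simp
  moreover have "?I = (LINT x|\<rho>. g x) - mean g"
    unfolding f_def using int[OF g] prob_space by simp
  ultimately show ?thesis by simp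
qed

theorem equilibrium_iff_mean_measure: "equilibrium_probability d U \<alpha> \<longleftrightarrow> \<alpha> = mean_measure"
proof -
  have "\<rho> = mean_measure" if "equilibrium_candidate d U \<rho>" for \<rho>
    using that eq_mean_measureI candidate_integral by (simp add: equilibrium_candidate_def)
  then show ?thesis
    unfolding equilibrium_probability_def using mean_measure_candidate by blast
qed

end

theorem theorem18:
  fixes d :: nat and U :: "(int \<Rightarrow> nat) \<Rightarrow> real"
  assumes "d \<ge> 1" and "finite_range_potential d U"
  shows "(\<forall>\<alpha>. borel_probability d \<alpha> \<longrightarrow>
            (equilibrium_probability d U \<alpha> \<longleftrightarrow> c_star_gibbs d U \<alpha>)) \<and>
         (\<exists>!\<alpha>. borel_probability d \<alpha> \<and> c_star_gibbs d U \<alpha>)"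
proof -
  obtain F where F: "finite F" "F \<subseteq> - {0}" "depends_on d F U"
    using assms(2) unfolding finite_range_potential_def depends_on_def by blast
  define r where "r = nat (\<Sum>j\<in>F. \<bar>j\<bar>)"
  have "\<bar>j\<bar> \<le> (\<Sum>j\<in>F. \<bar>j\<bar>)" if "j \<in> F" for j
    using F(1) that by (intro member_le_sum) auto
  then have "F \<subseteq> window r"
    using F(2) by (force simp: window_def r_def)
  with F(3) have r: "depends_on d (window r) U"
    by (rule depends_on_mono)
  have U: "local_fun d U"
    using r by (auto simp: local_fun_def)
  obtain B where B: "\<And>x. x \<in> seq_space d \<Longrightarrow> \<bar>U x\<bar> \<le> B"
    using local_fun_bounded[OF assms(1) U] unfolding real_norm_def by blast
  interpret finite_range_system d U r B
    by unfold_locales (use assms(1) r B in auto)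
  \<comment> \<open>Both notions single out \<open>mean_measure\<close>, so the equivalence and the
    unique existence come together.\<close>
  show ?thesis
    using gibbs_iff_mean_measure equilibrium_iff_mean_measure mean_measure_borel by blast
qed

end
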